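(* For $m\in\mathbb N$ let $\mathcal{GD}_m$ be GDIFSs on the same directed graph with the same spaces $(X_{v_j})$ and the same condensation sets $C_1,\dots,C_N$, consisting of similarity maps $(f_e^m)_{e\in E^1}$. Suppose that for each $e\in E^1$ the sequence $(f_e^m)_m$ converges to $f_e$ as $m\to\infty$, and let $\mathcal{GD}$ be the GDIFS with the same vertices, edges, spaces and condensation sets and with maps $(f_e)_{e\in E^1}$. Suppose that $\mathcal{GD}$ and all $\mathcal{GD}_m$, $m\in\mathbb N$, satisfy the GD inhomogeneous open set condition (GDIOSC). Let $(F_1^m,\dots,F_N^m)$ and $(F_1,\dots,F_N)$ be the inhomogeneous GD fractal sets of $\mathcal{GD}_m$ and $\mathcal{GD}$. Then, for each $1\le i\le N$, as $m\to\infty$: (1) $\overline{\dim}_B(F_i^m)\to\overline{\dim}_B(F_i)$, provided that $\overline{\dim}_B(C_i)=\overline{\dim}_B(C_j)$ for all $1\le i,j\le N$; (2) $\dim_H(F_i^m)\to\dim_H(F_i)$, provided that $\dim_H(C_i)=\dim_H(C_j)$ for all $1\le i,j\le N$.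
   Context: Graph. $V=\{v_1,\dots,v_N\}$ is the vertex set of a finite directed graph (parallel edges and loops allowed) that is strongly connected: any vertex can be joined to any vertex by a directed path. $E^1$ is the set of edges; $i(e)$ and $t(e)$ are the initial and terminal vertices of an edge $e$. $E_j^1$ is the set of edges with initial vertex $v_j$. A quantity indexed by a vertex $v_j$ may be indexed by $j$. GDIFS. To each vertex $v_j$ is attached a complete metric space $(X_{v_j},d_{v_j})$, a copy of $\mathbb{R}^n$ with the Euclidean metric, and to each edge $e\in E^1$ a contraction $f_e:X_{t(e)}\to X_{i(e)}$ with contraction ratio $\rho_e\in[0,1)$. Condensation sets $C_j\subset X_{v_j}$ are fixed non-empty compact sets. A similarity with ratio $\rho$ is a map satisfying $\|f(x)-f(y)\|_2=\rho\|x-y\|_2$ for all $x,y$. Fractal set: $(F_1,\dots,F_N)$ is the list of non-empty compact sets $F_j\subset X_{v_j}$ with $F_j=\bigcup_{e\in E_j^1}f_e(F_{t(e)})\cup C_j$ for all $j$. GDIOSC (for a GDIFS with maps $f_e$): there exist non-empty bounded open sets $U_j\subset X_{v_j}$ ($1\le j\le N$) such that (i) $f_e(U_{t(e)})\subset U_j$ for each $j$ and each $e\in E_j^1$; (ii) $f_e(U_{t(e)})\cap f_{e'}(U_{t(e')})=\emptyset$ for all edges $e\ne e'$ (sets lying in the spaces of different vertices being regarded as disjoint); (iii) $C_j\subseteq\overline{U}_j$ for each $j$. $\dim_H$ is Hausdorff dimension; $\overline{\dim}_B(S)=\limsup_{\delta\to0^+}\frac{\log N_\delta(S)}{-\log\delta}$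 for non-empty bounded $S$, where $N_\delta(S)$ is the minimum number of sets of diameter $\delta$ needed to cover $S$.
   Formalization: The limit maps f_e are additionally assumed to be similarities with ratio strictly positive; if a limit map may be constant (ratio 0), the claim fails, e.g. for a two-vertex system on the line whose connecting map collapses to a point. *)

theory Defs
  imports
    "HOL-Analysis.Analysis"
    "Graph_Theory.Digraph_Component"
begin


text \<open>The boundedness conditions below guard against the junk value of
  \<^const>\<open>diameter\<close> at unbounded sets.\<close>

definition covering_number :: "real \<Rightarrow> 'a::metric_space set \<Rightarrow> nat" where
  "covering_number \<delta> S =
     (LEAST k. \<exists>\<U>. finite \<U> \<and> card \<U> = k \<and> S \<subseteq> \<Union>\<U> \<and>
                (\<forall>A\<in>\<U>. bounded A \<and> diameter A = \<delta>))"

definition upper_box_dim :: "'a::metric_space set \<Rightarrow> ereal" where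
  "upper_box_dim S =
     Limsup (at_right 0) (\<lambda>\<delta>::real. ereal (ln (real (covering_number \<delta> S)) / (- ln \<delta>)))"

text \<open>The power \<open>(diam A)\<^sup>s\<close>, with the usual conventions for Hausdorff measures:
  the empty set contributes \<open>0\<close>, and \<open>0\<^sup>0 = 1\<close> for nonempty sets
  (whereas \<open>0 powr 0 = 0\<close>).\<close>

definition diam_power :: "real \<Rightarrow> 'a::metric_space set \<Rightarrow> ennreal" where
  "diam_power s A =
     (if A = {} then 0 else if s = 0 then 1 else ennreal (diameter A powr s))"

definition hausdorff_premeasure :: "real \<Rightarrow> real \<Rightarrow> 'a::metric_space set \<Rightarrow> ennreal" where
  "hausdorff_premeasure s \<delta> S =
     (INF A \<in> {A :: nat \<Rightarrow> 'a set. S \<subseteq> (\<Union>i. A i) \<and> (\<forall>i. bounded (A i) \<and> diameter (A i) \<le> \<delta>)}.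
        \<Sum>i. diam_power s (A i))"

definition hausdorff_measure :: "real \<Rightarrow> 'a::metric_space set \<Rightarrow> ennreal" where
  "hausdorff_measure s S = (SUP \<delta>\<in>{0<..}. hausdorff_premeasure s \<delta> S)"

definition hausdorff_dim :: "'a::metric_space set \<Rightarrow> ereal" where
  "hausdorff_dim S = Inf {ereal s | s. 0 \<le> s \<and> hausdorff_measure s S = 0}"



text \<open>The initial and terminal vertices of an edge \<open>e\<close> are \<open>tail G e\<close> and \<open>head G e\<close>;
  the edges starting at \<open>v\<close> are \<open>out_arcs G v\<close>. The space attached to each vertex is a copy
  of \<open>\<real>\<^sup>n\<close>; all copies are represented by the same type, and a family of subsets of these spaces
  is a function on vertices, of which only the values on \<open>verts G\<close> matter.
  Likewise only the maps \<open>f e\<close> with \<open>e \<in> arcs G\<close> matter.\<close>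

definition similarity :: "real \<Rightarrow> ('a::real_normed_vector \<Rightarrow> 'a) \<Rightarrow> bool" where
  "similarity \<rho> f \<longleftrightarrow> (\<forall>x y. norm (f x - f y) = \<rho> * norm (x - y))"

definition gdifs ::
  "('v, 'e) pre_digraph \<Rightarrow> ('v \<Rightarrow> 'a::euclidean_space set) \<Rightarrow> ('e \<Rightarrow> 'a \<Rightarrow> 'a) \<Rightarrow> bool" where
  "gdifs G C f \<longleftrightarrow>
     fin_digraph G \<and> strongly_connected G \<and>
     (\<forall>v\<in>verts G. compact (C v) \<and> C v \<noteq> {}) \<and>
     (\<forall>e\<in>arcs G. \<exists>\<rho>. 0 \<le> \<rho> \<and> \<rho> < 1 \<and> \<rho>-lipschitz_on UNIV (f e))"

definition gd_fractal ::
  "('v, 'e) pre_digraph \<Rightarrow> ('v \<Rightarrow> 'a::euclidean_space set) \<Rightarrow> ('e \<Rightarrow> 'a \<Rightarrow> 'a) \<Rightarrow>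
     ('v \<Rightarrow> 'a set) \<Rightarrow> bool" where
  "gd_fractal G C f F \<longleftrightarrow>
     (\<forall>v\<in>verts G. compact (F v) \<and> F v \<noteq> {} \<and>
        F v = (\<Union>e\<in>out_arcs G v. f e ` F (head G e)) \<union> C v)"

text \<open>Disjointness is only required for edges with the same initial vertex, since the images
  otherwise lie in the spaces of different vertices.\<close>

definition gdiosc ::
  "('v, 'e) pre_digraph \<Rightarrow> ('v \<Rightarrow> 'a::euclidean_space set) \<Rightarrow> ('e \<Rightarrow> 'a \<Rightarrow> 'a) \<Rightarrow> bool" where
  "gdiosc G C f \<longleftrightarrow>
     (\<exists>U :: 'v \<Rightarrow> 'a set.
        (\<forall>v\<in>verts G. open (U v) \<and> bounded (U v) \<and> U v \<noteq> {}) \<and>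
        (\<forall>v\<in>verts G. \<forall>e\<in>out_arcs G v. f e ` U (head G e) \<subseteq> U v) \<and>
        (\<forall>e\<in>arcs G. \<forall>e'\<in>arcs G. e \<noteq> e' \<and> tail G e = tail G e' \<longrightarrow>
           f e ` U (head G e) \<inter> f e' ` U (head G e') = {}) \<and>
        (\<forall>v\<in>verts G. C v \<subseteq> closure (U v)))"

end

theory Submission
  imports Defs
begin

text \<open>
  For a system of similarities with ratios \<open>r\<^sub>e\<close> let
  \<open>(A\<^sub>t h)\<^sub>v = \<Sum>\<^sub>e r\<^sub>e\<^sup>t h\<^bsub>head e\<^esub>\<close>, summing over the edges starting at \<open>v\<close>.
  A positive \<open>h\<close> with \<open>A\<^sub>t h < h\<close> forces the dimensions of the fractal sets to be at most \<open>t\<close>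
  whenever those of the condensation sets are below \<open>t\<close>; a positive \<open>h\<close> with \<open>A\<^sub>t h > h\<close> together
  with the open set condition forces them to be at least \<open>t\<close>. There is a critical exponent \<open>s\<close>
  of the limit system such that the first kind of \<open>h\<close> exists for all \<open>t > s\<close> and the second for all
  \<open>0 \<le> t < s\<close>. Both strict inequalities survive small perturbations of the ratios, so the
  dimensions along the sequence are squeezed to \<open>max s D\<close>, where \<open>D\<close> is the common dimension of the
  condensation sets; the constant sequence shows that this is also the dimension of the limit.
\<close>

section \<open>The critical exponent of a weighted graph\<close>

text \<open>An eigenvector of A at the critical exponent would depend on the ratios and would have
  to be followed along the sequence. A fixed positive \<open>h\<close> with a strict inequality at
  an exponent slightly off the critical one serves all nearby systems at once, and every estimate
  leaves room to choose such an exponent.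

  The ratios differ from edge to edge, so words of equal length do not describe pieces of equal
  size. The box-counting bound and the mass bound are therefore proved by induction over scales:
  pulling a ball of radius d back along an edge \<open>e\<close> gives radius
  \<open>d / r e\<close>, and a counter k with \<open>rmax ^ k \<le> d\<close> drops by one. The
  descent stops once the scale lies between 1 and \<open>1 / rmin\<close>, where compactness or
  boundedness settles the claim with a fixed constant.

  For the lower bound, the open set condition must limit how much mass a ball can carry. Volume
  inside the open sets measures this: it adds up over disjoint images and so fits the induction over
  scales.\<close>

definition transfer ::
  "('v, 'e) pre_digraph \<Rightarrow> ('e \<Rightarrow> real) \<Rightarrow> real \<Rightarrow> ('v \<Rightarrow> real) \<Rightarrow> 'v \<Rightarrow> real" where
  "transfer G r t h v = (\<Sum>e\<in>out_arcs G v. r e powr t * h (head G e))"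

definition subvector ::
  "('v, 'e) pre_digraph \<Rightarrow> ('e \<Rightarrow> real) \<Rightarrow> real \<Rightarrow> ('v \<Rightarrow> real) \<Rightarrow> bool" where
  "subvector G r t h \<longleftrightarrow> (\<forall>v\<in>verts G. 0 < h v \<and> transfer G r t h v < h v)"

definition supervector ::
  "('v, 'e) pre_digraph \<Rightarrow> ('e \<Rightarrow> real) \<Rightarrow> real \<Rightarrow> ('v \<Rightarrow> real) \<Rightarrow> bool" where
  "supervector G r t h \<longleftrightarrow> (\<forall>v\<in>verts G. 0 < h v \<and> h v < transfer G r t h v)"

primrec neumann ::
  "('v, 'e) pre_digraph \<Rightarrow> ('e \<Rightarrow> real) \<Rightarrow> real \<Rightarrow> nat \<Rightarrow> 'v \<Rightarrow> real" where
  "neumann G r t 0 = (\<lambda>v. 1)"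
| "neumann G r t (Suc n) = (\<lambda>v. 1 + transfer G r t (neumann G r t n) v)"

locale ratio_graph = fin_digraph G for G :: "('v, 'e) pre_digraph" +
  fixes r :: "'e \<Rightarrow> real"
  assumes ratio_pos: "e \<in> arcs G \<Longrightarrow> 0 < r e"
    and ratio_less_1: "e \<in> arcs G \<Longrightarrow> r e < 1"
    and strong: "strongly_connected G"
begin

lemma out_arcs_arcs: "e \<in> out_arcs G v \<Longrightarrow> e \<in> arcs G"
  by (auto simp: out_arcs_def)

lemma transfer_mono:
  assumes "\<And>w. w \<in> verts G \<Longrightarrow> h w \<le> k w"
  shows "transfer G r t h v \<le> transfer G r t k v"
  unfolding transfer_def
  by (intro sum_mono mult_left_mono assms) (auto simp: out_arcs_arcs)

lemma transfer_antimono_exponent: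
  assumes "t \<le> t'" "\<And>w. w \<in> verts G \<Longrightarrow> 0 \<le> h w"
  shows "transfer G r t' h v \<le> transfer G r t h v"
  unfolding transfer_def
  by (intro sum_mono mult_right_mono assms powr_mono')
    (auto simp: out_arcs_arcs assms intro: less_imp_le ratio_pos ratio_less_1)

lemma subvector_mono_exponent:
  assumes "subvector G r t h" "t \<le> t'"
  shows "subvector G r t' h"
  unfolding subvector_def
proof (intro ballI conjI)
  fix v assume v: "v \<in> verts G"
  then show "0 < h v" using assms(1) by (simp add: subvector_def)
  have "transfer G r t' h v \<le> transfer G r t h v"
    using assms by (intro transfer_antimono_exponent) (auto simp: subvector_def intro: less_imp_le)
  also have "\<dots> < h v" using assms(1) v by (simp add: subvector_def)
  finally show "transfer G r t' h v < h v" .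
qed

lemma neumann_le_Suc: "neumann G r t n v \<le> neumann G r t (Suc n) v"
proof (induction n arbitrary: v)
  case 0
  show ?case by (auto simp: transfer_def intro!: sum_nonneg)
next
  case (Suc n)
  then show ?case
    using transfer_mono[of "neumann G r t n" "neumann G r t (Suc n)" t v] by simp
qed

lemma neumann_mono: "m \<le> n \<Longrightarrow> neumann G r t m v \<le> neumann G r t n v"
  by (rule lift_Suc_mono_le[of "\<lambda>n. neumann G r t n v"]) (rule neumann_le_Suc)

lemma neumann_ge_1: "1 \<le> neumann G r t n v"
  using neumann_mono[of 0 n t v] by simp

text \<open>Bounded increasing sequences converge, and passing to the limit in the recursion gives
  \<open>h = 1 + A h\<close>; the constant term 1 makes the inequality strict.\<close>

lemma subvector_if_neumann_bounded:
  assumes "\<And>v. v \<in> verts G \<Longrightarrow> \<exists>B. \<forall>n. neumann G r t n v \<le> B"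
  shows "\<exists>h. subvector G r t h"
proof -
  define h where "h = (\<lambda>v. lim (\<lambda>n. neumann G r t n v))"
  have lim: "(\<lambda>n. neumann G r t n v) \<longlonglongrightarrow> h v" if v: "v \<in> verts G" for v
  proof -
    obtain B where B: "\<And>n. neumann G r t n v \<le> B" using assms[OF v] by blast
    have "norm (neumann G r t n v) \<le> B" for n
      using B[of n] neumann_ge_1[of t n v] by simp
    then have "convergent (\<lambda>n. neumann G r t n v)"
      by (intro Bseq_mono_convergent BseqI') (use neumann_mono in auto)
    then show ?thesis by (simp add: h_def convergent_LIMSEQ_iff)
  qed
  have "h v = 1 + transfer G r t h v" if v: "v \<in> verts G" for v
  proof (rule LIMSEQ_unique)
    show "(\<lambda>n. neumann G r t (Suc n) v) \<longlonglongrightarrow> h v"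
      using lim[OF v] by (rule LIMSEQ_Suc)
    show "(\<lambda>n. neumann G r t (Suc n) v) \<longlonglongrightarrow> 1 + transfer G r t h v"
      unfolding transfer_def neumann.simps
      by (intro tendsto_intros lim) (auto simp: out_arcs_arcs)
  qed
  moreover have "1 \<le> h v" if "v \<in> verts G" for v
    using lim[OF that] by (rule LIMSEQ_le_const) (auto simp: neumann_ge_1)
  ultimately show ?thesis
    by (intro exI[of _ h]) (force simp: subvector_def)
qed

text \<open>Divergence spreads backwards along edges: an edge from x to y makes the next partial sum
  at x at least \<open>r e powr t\<close> times the current one at y. Some vertex diverges, and
  every vertex reaches it.\<close>

lemma neumann_unbounded:
  assumes "\<nexists>h. subvector G r t h" "v \<in> verts G"
  shows "\<exists>n. B < neumann G r t n v"
proof -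
  obtain w where w: "w \<in> verts G" "\<And>B. \<exists>n. B < neumann G r t n w"
    using subvector_if_neumann_bounded[of t] assms(1) by (meson not_le)
  have "reachable G v w" using strong assms(2) w(1) by (auto simp: strongly_connected_def)
  then have "\<forall>B. \<exists>n. B < neumann G r t n v"
  proof (induction rule: converse_reachable_induct)
    case base
    then show ?case using w by blast
  next
    case (step x y)
    then obtain e where e: "e \<in> arcs G" "tail G e = x" "head G e = y" by auto
    show ?case
    proof
      fix B
      obtain n where n: "B / r e powr t < neumann G r t n y" using step.IH by blast
      have pos: "0 < r e powr t" using ratio_pos[OF e(1)] by simp
      have "B < r e powr t * neumann G r t n y"
        using n pos by (simp add: pos_divide_less_eq mult.commute)
      also have "\<dots> \<le> transfer G r t (neumann G r t n) x"
        unfolding transfer_def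
        using e neumann_ge_1[of t n]
        by (subst e(3)[symmetric], intro member_le_sum)
          (auto simp: out_arcs_def intro!: mult_nonneg_nonneg intro: order_trans[OF zero_le_one])
      also have "\<dots> \<le> neumann G r t (Suc n) x" by simp
      finally show "\<exists>n. B < neumann G r t n x" by blast
    qed
  qed
  then show ?thesis by blast
qed

text \<open>If the Neumann series \<open>\<Sum>\<^sub>k A\<^sub>t\<^sup>k 1\<close> at \<open>t'\<close> diverges, its partial sums \<open>h\<close> become large at every
  vertex by strong connectivity. Since \<open>A h \<ge> h - 1\<close> at \<open>t'\<close>, and passing to \<open>t < t'\<close> gains a factor
  \<open>c > 1\<close>, a late partial sum is a supervector at \<open>t\<close>.\<close>

lemma supervector_below:
  assumes "\<nexists>h. subvector G r t' h" "t < t'"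
  shows "\<exists>h. supervector G r t h"
proof -
  \<comment> \<open>The 2 keeps the minimum defined and above 1 if the graph has no edges.\<close>
  define c where "c = Min (insert 2 ((\<lambda>e. r e powr (t - t')) ` arcs G))"
  have "1 < r e powr (t - t')" if "e \<in> arcs G" for e
    using ratio_pos[OF that] ratio_less_1[OF that] assms(2)
    by (simp add: powr_def mult_neg_neg)
  then have c: "1 < c" by (simp add: c_def)
  have c_le: "c \<le> r e powr (t - t')" if "e \<in> arcs G" for e
    using that by (simp add: c_def)
  \<comment> \<open>The threshold is the point beyond which \<open>c * (h v - 1)\<close> exceeds
    \<open>h v\<close>.\<close>
  have "\<forall>v\<in>verts G. \<exists>n. c / (c - 1) < neumann G r t' n v"
    using neumann_unbounded[OF assms(1)] by blast
  then obtain N where N: "\<And>v. v \<in> verts G \<Longrightarrow> c / (c - 1) < neumann G r t' (N v) v"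
    by metis
  define n where "n = Max (N ` verts G)"
  define h where "h = neumann G r t' n"
  have "h v < transfer G r t h v" if v: "v \<in> verts G" for v
  proof -
    have "N v \<le> n" using v by (simp add: n_def)
    then have "c / (c - 1) < h v"
      using N[OF v] neumann_mono[of "N v" n t' v] by (simp add: h_def)
    then have "h v < c * (h v - 1)"
      using c by (simp add: field_simps)
    also have "\<dots> \<le> c * transfer G r t' h v"
      using c neumann_le_Suc[of t' n v] by (simp add: h_def)
    also have "\<dots> \<le> transfer G r t h v"
      unfolding transfer_def sum_distrib_left
    proof (rule sum_mono)
      fix e assume e: "e \<in> out_arcs G v"
      have "c * r e powr t' \<le> r e powr (t - t') * r e powr t'"
        by (intro mult_right_mono c_le) (auto simp: out_arcs_arcs[OF e])
      also have "\<dots> = r e powr t" by (simp flip: powr_add)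
      finally have "c * r e powr t' * h (head G e) \<le> r e powr t * h (head G e)"
        by (rule mult_right_mono) (simp add: h_def order_trans[OF zero_le_one neumann_ge_1])
      then show "c * (r e powr t' * h (head G e)) \<le> r e powr t * h (head G e)"
        by (simp add: mult.assoc)
    qed
    finally show ?thesis .
  qed
  moreover have "0 < h v" for v
    using neumann_ge_1[of t' n v] by (simp add: h_def)
  ultimately show ?thesis by (auto simp: supervector_def)
qed

text \<open>All ratios are below 1, so their powers tend to 0 as the exponent grows and the constant
  vector 1 eventually works. This keeps the infimum that defines the critical exponent
  meaningful.\<close>

lemma ex_subvector: "\<exists>t\<ge>0. \<exists>h. subvector G r t h"
proof -
  have "((\<lambda>t. r e powr t) \<longlongrightarrow> 0) at_top" if "e \<in> arcs G" for e
  proof -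
    have "filterlim (\<lambda>t. ln (r e) * t) at_bot at_top"
      using ratio_pos[OF that] ratio_less_1[OF that]
      by (intro filterlim_tendsto_neg_mult_at_bot[OF tendsto_const _ filterlim_ident]) simp
    then have "((\<lambda>t. exp (ln (r e) * t)) \<longlongrightarrow> 0) at_top"
      by (rule filterlim_compose[OF exp_at_bot])
    then show ?thesis
      using ratio_pos[OF that] by (simp add: powr_def mult.commute)
  qed
  then have "((\<lambda>t. transfer G r t (\<lambda>_. 1) v) \<longlongrightarrow> (\<Sum>e\<in>out_arcs G v. 0 * 1)) at_top" for v
    unfolding transfer_def by (intro tendsto_intros) (auto simp: out_arcs_arcs)
  then have "\<forall>\<^sub>F t in at_top. transfer G r t (\<lambda>_. 1) v < 1" for v
    by (intro order_tendstoD(2)[of _ 0]) auto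
  then have "\<forall>\<^sub>F t in at_top. \<forall>v\<in>verts G. transfer G r t (\<lambda>_. 1) v < 1"
    by (intro eventually_ball_finite) auto
  then have "\<forall>\<^sub>F t::real in at_top. 0 \<le> t \<and> (\<forall>v\<in>verts G. transfer G r t (\<lambda>_. 1) v < 1)"
    by (intro eventually_conj eventually_ge_at_top)
  then obtain t :: real where "0 \<le> t" "\<forall>v\<in>verts G. transfer G r t (\<lambda>_. 1) v < 1"
    using eventually_happens trivial_limit_at_top_linorder by fastforce
  then show ?thesis
    by (intro exI[of _ t] conjI exI[of _ "\<lambda>_. 1"]) (auto simp: subvector_def)
qed

text \<open>The exponent is the infimum of the nonnegative t that admit a subvector, a set closed
  upwards because the ratios are below 1.\<close>

lemma critical_exponent:
  obtains s where "0 \<le> s" "\<And>t. s < t \<Longrightarrow> \<exists>h. subvector G r t h"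
    "\<And>t. 0 \<le> t \<Longrightarrow> t < s \<Longrightarrow> \<exists>h. supervector G r t h"
proof
  define S where "S = {t. 0 \<le> t \<and> (\<exists>h. subvector G r t h)}"
  have ne: "S \<noteq> {}" and bdd: "bdd_below S"
    using ex_subvector by (auto simp: S_def intro!: bdd_belowI[of _ 0])
  show "0 \<le> Inf S" using ne by (intro cInf_greatest) (auto simp: S_def)
  show "\<exists>h. subvector G r t h" if t: "Inf S < t" for t
  proof -
    obtain u where "u \<in> S" "u < t" using t ne bdd cInf_less_iff by blast
    then show ?thesis using subvector_mono_exponent[of u _ t] by (force simp: S_def)
  qed
  show "\<exists>h. supervector G r t h" if t: "0 \<le> t" "t < Inf S" for t
  proof -
    \<comment> \<open>A supervector is gained only by lowering the exponent strictly, hence the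
      detour through an intermediate \<open>u\<close> without subvectors.\<close>
    obtain u where u: "t < u" "u < Inf S" using t dense by blast
    then have "u \<notin> S" using cInf_lower[OF _ bdd] by force
    then have "\<nexists>h. subvector G r u h" using t u by (auto simp: S_def)
    then show ?thesis using u supervector_below by blast
  qed
qed

end

section \<open>Covering numbers and upper box dimension\<close>

lemma finite_cball_cover:
  fixes S :: "'a::euclidean_space set"
  assumes "bounded S" "0 < d"
  obtains P where "finite P" "S \<subseteq> (\<Union>x\<in>P. cball x d)"
proof -
  have "compact (closure S)" using assms(1) by (simp add: compact_closure)
  then obtain P where "finite P" "closure S \<subseteq> (\<Union>x\<in>P. ball x d)"
    using assms(2) unfolding compact_eq_totally_bounded by meson
  then show thesis
    using closure_subset[of S] by (intro that[of P]) (force simp: subset_iff)+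
qed

text \<open>Closed balls of radius \<open>d / 2\<close> in a Euclidean space have diameter exactly
  \<open>d\<close>, as the definition of the covering number demands.\<close>

lemma covering_number_le_card:
  fixes S :: "'a::euclidean_space set"
  assumes "finite P" "S \<subseteq> (\<Union>x\<in>P. cball x (d / 2))" "0 < d"
  shows "covering_number d S \<le> card P"
proof -
  let ?U = "(\<lambda>x. cball x (d / 2)) ` P"
  have "covering_number d S \<le> card ?U"
    unfolding covering_number_def
    using assms by (intro Least_le exI[of _ ?U]) auto
  also have "\<dots> \<le> card P" using assms(1) by (rule card_image_le)
  finally show ?thesis .
qed

lemma covering_number_witness:
  fixes S :: "'a::euclidean_space set"
  assumes "bounded S" "0 < d"
  obtains \<U> where "finite \<U>" "card \<U> = covering_number d S" "S \<subseteq> \<Union>\<U>"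
    "\<And>A. A \<in> \<U> \<Longrightarrow> bounded A \<and> diameter A = d"
proof -
  obtain P where P: "finite P" "S \<subseteq> (\<Union>x\<in>P. cball x (d / 2))"
    using finite_cball_cover[of S "d / 2"] assms by auto
  let ?Q = "\<lambda>k. \<exists>\<U>. finite \<U> \<and> card \<U> = k \<and> S \<subseteq> \<Union>\<U> \<and> (\<forall>A\<in>\<U>. bounded A \<and> diameter A = d)"
  have "?Q (card ((\<lambda>x. cball x (d / 2)) ` P))"
    using P assms(2) by (intro exI[of _ "(\<lambda>x. cball x (d / 2)) ` P"]) auto
  then have "?Q (covering_number d S)" unfolding covering_number_def by (rule LeastI)
  then show thesis using that by blast
qed

text \<open>A set of diameter \<open>d\<close> lies in the closed ball of radius \<open>d\<close>
  about any of its points.\<close>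

lemma cball_cover_card_covering_number:
  fixes S :: "'a::euclidean_space set"
  assumes "bounded S" "0 < d"
  obtains P where "finite P" "card P \<le> covering_number d S" "S \<subseteq> (\<Union>x\<in>P. cball x d)"
proof -
  obtain \<U> where U: "finite \<U>" "card \<U> = covering_number d S" "S \<subseteq> \<Union>\<U>"
    "\<And>A. A \<in> \<U> \<Longrightarrow> bounded A \<and> diameter A = d"
    by (rule covering_number_witness[OF assms]) blast
  define c :: "'a set \<Rightarrow> 'a" where "c A = (SOME x. x \<in> A)" for A
  have "y \<in> cball (c A) d" if "A \<in> \<U>" "y \<in> A" for A y
  proof -
    have "c A \<in> A" unfolding c_def using that(2) by (rule someI)
    then show ?thesis
      using diameter_bounded_bound[of A "c A" y] U(4)[OF that(1)] that by simp
  qed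
  then have "\<Union>\<U> \<subseteq> (\<Union>x\<in>c ` \<U>. cball x d)" by blast
  then have "S \<subseteq> (\<Union>x\<in>c ` \<U>. cball x d)" using U(3) by (rule order_trans[rotated])
  then show thesis
    using U(1,2) card_image_le[of \<U> c] by (intro that[of "c ` \<U>"]) auto
qed

lemma covering_number_pos:
  fixes S :: "'a::euclidean_space set"
  assumes "bounded S" "0 < d" "S \<noteq> {}"
  shows "0 < covering_number d S"
proof -
  obtain P where P: "finite P" "card P \<le> covering_number d S" "S \<subseteq> (\<Union>x\<in>P. cball x d)"
    using cball_cover_card_covering_number[OF assms(1,2)] .
  then have "P \<noteq> {}" using assms(3) by auto
  then show ?thesis using P card_gt_0_iff[of P] by simp
qed

lemma covering_number_mono:
  fixes S :: "'a::euclidean_space set"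
  assumes "bounded T" "S \<subseteq> T" "0 < d"
  shows "covering_number d S \<le> covering_number d T"
proof -
  obtain \<U> where "finite \<U>" "card \<U> = covering_number d T" "T \<subseteq> \<Union>\<U>"
    "\<And>A. A \<in> \<U> \<Longrightarrow> bounded A \<and> diameter A = d"
    by (rule covering_number_witness[OF assms(1,3)]) blast
  then show ?thesis
    unfolding covering_number_def[of d S]
    using assms(2) by (intro Least_le exI[of _ \<U>]) auto
qed

lemma eventually_at_right_0_between:
  assumes "(a::real) > 0" shows "\<forall>\<^sub>F d in at_right 0. 0 < d \<and> d < a"
  using eventually_at_right_real[OF assms] by (simp add: eventually_mono)

lemma upper_box_dim_mono:
  fixes S :: "'a::euclidean_space set"
  assumes "bounded T" "S \<subseteq> T"
  shows "upper_box_dim S \<le> upper_box_dim T"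
  unfolding upper_box_dim_def
proof (rule Limsup_mono)
  show "\<forall>\<^sub>F d::real in at_right 0. ereal (ln (covering_number d S) / - ln d)
      \<le> ereal (ln (covering_number d T) / - ln d)"
    using eventually_at_right_0_between[of 1]
  proof (rule eventually_mono)
    fix d :: real assume d: "0 < d \<and> d < 1"
    have "ln (real (covering_number d S)) \<le> ln (real (covering_number d T))"
      using covering_number_mono[OF assms, of d] d
      by (cases "covering_number d S = 0"; cases "covering_number d T = 0") auto
    then show "ereal (ln (covering_number d S) / - ln d) \<le> ereal (ln (covering_number d T) / - ln d)"
      using d by (simp add: divide_right_mono_neg)
  qed simp
qed

lemma tendsto_div_ln_at_right_0: "((\<lambda>d::real. t + a / (- ln d)) \<longlongrightarrow> t) (at_right 0)"
proof -
  have "((\<lambda>d::real. a / (- ln d)) \<longlongrightarrow> 0) (at_right 0)"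
    using ln_at_0 by (intro real_tendsto_divide_at_top[OF tendsto_const])
      (simp add: filterlim_uminus_at_bot)
  then show ?thesis using tendsto_add[OF tendsto_const[of t]] by fastforce
qed

text \<open>A power bound with one constant for all scales up to 1. Unlike a bound on a limes
  superior, it can be carried through an induction over scales.\<close>

definition box_bounded :: "real \<Rightarrow> 'a::metric_space set \<Rightarrow> bool" where
  "box_bounded t S \<longleftrightarrow> (\<exists>K>0. \<forall>d. 0 < d \<and> d \<le> 1 \<longrightarrow>
     (\<exists>P. finite P \<and> real (card P) \<le> K * d powr - t \<and> S \<subseteq> (\<Union>x\<in>P. cball x d)))"

text \<open>The limes superior controls only small scales. For the remaining ones a single finite
  cover at scale \<open>a\<close> serves, and its cardinality is absorbed into the constant.\<close>

lemma box_bounded_if_upper_box_dim_less: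
  fixes S :: "'a::euclidean_space set"
  assumes "bounded S" "upper_box_dim S < ereal t" "0 \<le> t"
  shows "box_bounded t S"
proof -
  have "\<forall>\<^sub>F d::real in at_right 0. ereal (ln (covering_number d S) / - ln d) < ereal t"
    using assms(2) unfolding upper_box_dim_def by (rule Limsup_lessD)
  then have "\<forall>\<^sub>F d::real in at_right 0. ln (covering_number d S) / - ln d < t"
    by simp
  then obtain b where b: "0 < b" "\<And>d. 0 < d \<Longrightarrow> d < b \<Longrightarrow> ln (covering_number d S) / - ln d < t"
    unfolding eventually_at_right_field by blast
  define a where "a = min b 1 / 2"
  have a: "0 < a" "a < b" "a < 1" using b(1) by (auto simp: a_def)
  obtain P0 where P0: "finite P0" "S \<subseteq> (\<Union>x\<in>P0. cball x a)"
    using finite_cball_cover[OF assms(1) a(1)] .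
  show ?thesis
    unfolding box_bounded_def
  proof (intro exI[of _ "1 + real (card P0)"] conjI allI impI)
    fix d :: real assume d: "0 < d \<and> d \<le> 1"
    show "\<exists>P. finite P \<and> real (card P) \<le> (1 + real (card P0)) * d powr - t \<and> S \<subseteq> (\<Union>x\<in>P. cball x d)"
    proof (cases "d \<le> a")
      case True
      then have d1: "d < b" "d < 1" using a by auto
      obtain P where P: "finite P" "card P \<le> covering_number d S" "S \<subseteq> (\<Union>x\<in>P. cball x d)"
        using cball_cover_card_covering_number[OF assms(1)] d by blast
      have "real (covering_number d S) \<le> d powr - t"
      \<comment> \<open>The logarithm determines the count only when the count is positive.\<close>
      proof (cases "covering_number d S = 0")
        case False
        then have "ln (covering_number d S) < t * - ln d"
          using b(2)[of d] d d1 by (subst pos_divide_less_eq[symmetric]) auto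
        then have "exp (ln (real (covering_number d S))) \<le> d powr - t"
          using d by (simp add: powr_def)
        then show ?thesis using False by simp
      qed simp
      moreover have "0 \<le> real (card P0) * d powr - t" by simp
      ultimately have "real (card P) \<le> (1 + real (card P0)) * d powr - t"
        using P(2) unfolding distrib_right by linarith
      then show ?thesis using P by blast
    next
      case False
      have "1 \<le> d powr - t"
        using d assms(3) powr_mono'[of "-t" 0 d] by simp
      then have "(1 + real (card P0)) * 1 \<le> (1 + real (card P0)) * d powr - t"
        by (intro mult_left_mono) auto
      then have "real (card P0) \<le> (1 + real (card P0)) * d powr - t"
        by (rule order_trans[rotated]) simp
      moreover have "S \<subseteq> (\<Union>x\<in>P0. cball x d)"
        using P0(2) False subset_cball[of a d] by (meson UN_mono linorder_not_le order_refl less_imp_le order_trans)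
      ultimately show ?thesis using P0(1) by blast
    qed
  qed auto
qed

text \<open>Dividing by \<open>- ln d\<close> turns the constant of the power bound into a term that
  vanishes as \<open>d\<close> tends to 0.\<close>

lemma upper_box_dim_le_if_box_bounded:
  fixes S :: "'a::euclidean_space set"
  assumes "bounded S" "S \<noteq> {}" "box_bounded t S"
  shows "upper_box_dim S \<le> ereal t"
proof -
  obtain K where K: "0 < K" "\<And>d. 0 < d \<Longrightarrow> d \<le> 1 \<Longrightarrow>
     \<exists>P. finite P \<and> real (card P) \<le> K * d powr - t \<and> S \<subseteq> (\<Union>x\<in>P. cball x d)"
    using assms(3) unfolding box_bounded_def by blast
  \<comment> \<open>The factor \<open>2 powr t\<close> pays for balls of radius
    \<open>d / 2\<close>, which have diameter \<open>d\<close>.\<close>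
  define L where "L = K * 2 powr t"
  have L: "0 < L" using K(1) by (simp add: L_def)
  have le: "ln (covering_number d S) / - ln d \<le> t + ln L / - ln d" if d: "0 < d" "d < 1" for d :: real
  proof -
    obtain P where P: "finite P" "real (card P) \<le> K * (d / 2) powr - t" "S \<subseteq> (\<Union>x\<in>P. cball x (d / 2))"
      using K(2)[of "d / 2"] d by auto
    have "K * (d / 2) powr - t = L * d powr - t"
      using d by (simp add: L_def powr_divide powr_minus divide_simps)
    then have "real (covering_number d S) \<le> L * d powr - t"
      using covering_number_le_card[OF P(1,3) d(1)] P(2) by linarith
    then have "ln (covering_number d S) \<le> ln (L * d powr - t)"
      using covering_number_pos[OF assms(1) d(1) assms(2)] by (subst ln_le_cancel_iff) auto
    also have "\<dots> = ln L - t * ln d" using L d by (simp add: ln_mult ln_powr)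
    finally show ?thesis using d by (simp add: field_simps)
  qed
  have "upper_box_dim S \<le> Limsup (at_right 0) (\<lambda>d::real. ereal (t + ln L / - ln d))"
    unfolding upper_box_dim_def
    by (intro Limsup_mono eventually_mono[OF eventually_at_right_0_between[of 1]]) (use le in auto)
  also have "\<dots> = ereal t"
    by (intro lim_imp_Limsup) (simp_all only: trivial_limit_at_right_real lim_ereal tendsto_div_ln_at_right_0 not_False_eq_True)
  finally show ?thesis .
qed

text \<open>The hypothesis has the form in which a mass distribution delivers it: total mass 1, and
  mass at most \<open>c * d powr t\<close> for each ball of radius \<open>d\<close>.\<close>

lemma upper_box_dim_ge:
  fixes S :: "'a::euclidean_space set"
  assumes "bounded S" "S \<noteq> {}" "0 < c"
    and cover: "\<And>P d. finite P \<Longrightarrow> 0 < d \<Longrightarrow> d \<le> 1 \<Longrightarrow> S \<subseteq> (\<Union>x\<in>P. cball x d) \<Longrightarrow>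
      1 \<le> c * (real (card P) * d powr t)"
  shows "ereal t \<le> upper_box_dim S"
proof -
  have ge: "t + (- ln c) / - ln d \<le> ln (covering_number d S) / - ln d" if d: "0 < d" "d < 1" for d :: real
  proof -
    obtain P where P: "finite P" "card P \<le> covering_number d S" "S \<subseteq> (\<Union>x\<in>P. cball x d)"
      using cball_cover_card_covering_number[OF assms(1) d(1)] .
    have pos: "0 < covering_number d S" using assms d by (intro covering_number_pos)
    have "1 \<le> c * (real (card P) * d powr t)" using P d by (intro cover) auto
    also have "\<dots> \<le> c * (real (covering_number d S) * d powr t)"
      using P(2) assms(3) by (intro mult_left_mono mult_right_mono) auto
    finally have "ln 1 \<le> ln (c * (real (covering_number d S) * d powr t))"
      by (subst ln_le_cancel_iff) auto
    also have "\<dots> = ln c + ln (covering_number d S) + t * ln d"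
      using pos d assms(3) by (simp add: ln_mult ln_powr)
    finally have "(- ln c + t * - ln d) / - ln d \<le> ln (covering_number d S) / - ln d"
      using d by (intro divide_right_mono) auto
    moreover have "(- ln c + t * - ln d) / - ln d = t + (- ln c) / - ln d"
      using d by (simp add: add_divide_distrib diff_divide_distrib)
    ultimately show ?thesis by simp
  qed
  have "ereal t = Limsup (at_right 0) (\<lambda>d::real. ereal (t + (- ln c) / - ln d))"
    by (intro lim_imp_Limsup[symmetric]) (simp_all only: trivial_limit_at_right_real lim_ereal tendsto_div_ln_at_right_0 not_False_eq_True)
  also have "\<dots> \<le> upper_box_dim S"
    unfolding upper_box_dim_def
    by (intro Limsup_mono eventually_mono[OF eventually_at_right_0_between[of 1]]) (use ge in auto)
  finally show ?thesis .
qed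

section \<open>Hausdorff premeasures and Hausdorff dimension\<close>

abbreviation hausdorff_covers :: "real \<Rightarrow> 'a::metric_space set \<Rightarrow> (nat \<Rightarrow> 'a set) set" where
  "hausdorff_covers d S \<equiv> {A. S \<subseteq> (\<Union>i. A i) \<and> (\<forall>i. bounded (A i) \<and> diameter (A i) \<le> d)}"

lemma hausdorff_premeasure_le:
  "A \<in> hausdorff_covers d S \<Longrightarrow> hausdorff_premeasure s d S \<le> (\<Sum>i. diam_power s (A i))"
  unfolding hausdorff_premeasure_def by (rule INF_lower)

lemma hausdorff_premeasure_mono:
  "S \<subseteq> T \<Longrightarrow> hausdorff_premeasure s d S \<le> hausdorff_premeasure s d T"
  unfolding hausdorff_premeasure_def by (rule INF_superset_mono) auto

lemma hausdorff_measure_eq_0_iff: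
  "hausdorff_measure s S = 0 \<longleftrightarrow> (\<forall>d>0. hausdorff_premeasure s d S = 0)"
  unfolding hausdorff_measure_def bot_ennreal[symmetric] SUP_bot_conv by auto

lemma hausdorff_dim_mono: "S \<subseteq> T \<Longrightarrow> hausdorff_dim S \<le> hausdorff_dim T"
  unfolding hausdorff_dim_def hausdorff_measure_eq_0_iff
  using hausdorff_premeasure_mono[of S T]
  by (intro Inf_superset_mono Collect_mono) (metis le_zero_eq)

lemma hausdorff_dim_nonneg: "0 \<le> hausdorff_dim S"
  unfolding hausdorff_dim_def by (rule Inf_greatest) auto

lemma hausdorff_dim_le: "0 \<le> t \<Longrightarrow> hausdorff_measure t S = 0 \<Longrightarrow> hausdorff_dim S \<le> ereal t"
  unfolding hausdorff_dim_def by (rule Inf_lower) auto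

lemma hausdorff_premeasure_empty: "0 < d \<Longrightarrow> hausdorff_premeasure s d {} = 0"
  using hausdorff_premeasure_le[of "\<lambda>_. {}" "{}" d s] by (simp add: diam_power_def)

lemma suminf_interleave_ennreal:
  fixes f g :: "nat \<Rightarrow> ennreal"
  shows "(\<Sum>i. if even i then f (i div 2) else g (i div 2)) = suminf f + suminf g"
proof (rule sums_unique[symmetric])
  let ?h = "\<lambda>i. if even i then f (i div 2) else g (i div 2)"
  have e: "(\<Sum>i<2 * n. ?h i) = (\<Sum>i<n. f i) + (\<Sum>i<n. g i)" for n
    by (induction n) (auto simp: algebra_simps)
  have "(\<lambda>n. \<Sum>i<2 * n. ?h i) \<longlonglongrightarrow> suminf f + suminf g"
    unfolding e by (intro tendsto_add summable_LIMSEQ) auto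
  moreover have "(\<lambda>n. \<Sum>i<2 * n. ?h i) \<longlonglongrightarrow> suminf ?h"
    using LIMSEQ_subseq_LIMSEQ[OF summable_LIMSEQ[OF summableI], of "\<lambda>n. 2 * n" ?h]
    by (simp add: o_def strict_mono_def)
  ultimately have "suminf ?h = suminf f + suminf g" by (rule LIMSEQ_unique[rotated])
  then show "?h sums (suminf f + suminf g)"
    using summable_sums[OF summableI, of ?h] by simp
qed

text \<open>Two nearly optimal covers are interleaved into one sequence. Near-optimal choices exist
  because the right-hand side may be assumed finite.\<close>

lemma hausdorff_premeasure_Un:
  "hausdorff_premeasure s d (S \<union> T) \<le> hausdorff_premeasure s d S + hausdorff_premeasure s d T"
proof -
  have "hausdorff_premeasure s d (S \<union> T) \<le> (\<Sum>i. diam_power s (A i)) + (\<Sum>i. diam_power s (B i))"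
    if A: "A \<in> hausdorff_covers d S" and B: "B \<in> hausdorff_covers d T" for A B
  proof -
    let ?C = "\<lambda>i. if even i then A (i div 2) else B (i div 2)"
    have "A i = ?C (2 * i)" "B i = ?C (2 * i + 1)" for i by auto
    then have "(\<Union>i. A i) \<subseteq> (\<Union>i. ?C i)" "(\<Union>i. B i) \<subseteq> (\<Union>i. ?C i)" by blast+
    then have "S \<union> T \<subseteq> (\<Union>i. ?C i)" using A B by blast
    then have "?C \<in> hausdorff_covers d (S \<union> T)" using A B by simp
    then have "hausdorff_premeasure s d (S \<union> T) \<le> (\<Sum>i. diam_power s (?C i))"
      by (rule hausdorff_premeasure_le)
    also have "\<dots> = (\<Sum>i. if even i then diam_power s (A (i div 2)) else diam_power s (B (i div 2)))"
      by (intro arg_cong[of _ _ suminf] ext) simp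
    finally show ?thesis 
      unfolding suminf_interleave_ennreal[of "\<lambda>i. diam_power s (A i)" "\<lambda>i. diam_power s (B i)"] .
  qed
  note le = this
  show ?thesis
  proof (rule ennreal_le_epsilon)
    fix e :: real
    assume fin: "hausdorff_premeasure s d S + hausdorff_premeasure s d T < top" and e: "0 < e"
    have "hausdorff_premeasure s d S < hausdorff_premeasure s d S + ennreal (e / 2)"
      "hausdorff_premeasure s d T < hausdorff_premeasure s d T + ennreal (e / 2)"
      using fin e by (simp_all add: ennreal_add_left_cancel_less less_top[symmetric] ennreal_add_eq_top)
    then obtain A B where A: "A \<in> hausdorff_covers d S"
        "(\<Sum>i. diam_power s (A i)) < hausdorff_premeasure s d S + ennreal (e / 2)"
      and B: "B \<in> hausdorff_covers d T"
        "(\<Sum>i. diam_power s (B i)) < hausdorff_premeasure s d T + ennreal (e / 2)"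
      unfolding hausdorff_premeasure_def INF_less_iff by blast
    have "hausdorff_premeasure s d (S \<union> T) \<le> (\<Sum>i. diam_power s (A i)) + (\<Sum>i. diam_power s (B i))"
      by (rule le[OF A(1) B(1)])
    also have "\<dots> \<le> (hausdorff_premeasure s d S + ennreal (e / 2)) + (hausdorff_premeasure s d T + ennreal (e / 2))"
      using A(2) B(2) by (intro add_mono less_imp_le)
    also have "\<dots> = hausdorff_premeasure s d S + hausdorff_premeasure s d T + ennreal (e / 2 + e / 2)"
      using e by (subst ennreal_plus) (auto simp: ac_simps)
    finally show "hausdorff_premeasure s d (S \<union> T)
        \<le> hausdorff_premeasure s d S + hausdorff_premeasure s d T + ennreal e" by simp
  qed
qed

lemma hausdorff_premeasure_UN:
  assumes "finite I" "0 < d"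
  shows "hausdorff_premeasure s d (\<Union>i\<in>I. S i) \<le> (\<Sum>i\<in>I. hausdorff_premeasure s d (S i))"
  using assms(1)
proof induction
  case (insert i I)
  have "hausdorff_premeasure s d (S i \<union> (\<Union>i\<in>I. S i))
      \<le> hausdorff_premeasure s d (S i) + hausdorff_premeasure s d (\<Union>i\<in>I. S i)"
    by (rule hausdorff_premeasure_Un)
  also have "\<dots> \<le> hausdorff_premeasure s d (S i) + (\<Sum>i\<in>I. hausdorff_premeasure s d (S i))"
    using insert.IH by (rule add_left_mono)
  finally show ?case using insert by simp
qed (simp add: hausdorff_premeasure_empty assms)

text \<open>At a fixed positive scale finitely many balls suffice, whereas the measure itself may be
  infinite. Finiteness allows the premeasures of the fractal sets to be treated as a real
  vector.\<close>

lemma hausdorff_premeasure_finite: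
  fixes S :: "'a::euclidean_space set"
  assumes "bounded S" "0 < d"
  shows "hausdorff_premeasure s d S < top"
proof -
  obtain P where P: "finite P" "S \<subseteq> (\<Union>x\<in>P. cball x (d / 2))"
    using finite_cball_cover[of S "d / 2"] assms by auto
  have "hausdorff_premeasure s d S \<le> (\<Sum>x\<in>P. hausdorff_premeasure s d (cball x (d / 2)))"
    using hausdorff_premeasure_mono[OF P(2)] hausdorff_premeasure_UN[OF P(1) assms(2)] by (rule order_trans)
  also have "\<dots> < top"
  proof -
    have "hausdorff_premeasure s d (cball x (d / 2)) < top" for x :: 'a
    proof -
    let ?A = "\<lambda>i::nat. if i = 0 then cball x (d / 2) else {}"
    have "hausdorff_premeasure s d (cball x (d / 2)) \<le> (\<Sum>i. diam_power s (?A i))"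
      using assms(2) by (intro hausdorff_premeasure_le) auto
    also have "\<dots> = (\<Sum>i\<in>{0}. diam_power s (?A i))"
      by (intro suminf_finite) (auto simp: diam_power_def)
    also have "\<dots> < top" by (auto simp: diam_power_def)
    finally show ?thesis .
    qed
    then show ?thesis using P(1) by simp
  qed
  finally show ?thesis .
qed

section \<open>Premeasures under similarities and a change of exponent\<close>

lemma similarity_dist: "similarity \<rho> f \<Longrightarrow> dist (f x) (f y) = \<rho> * dist x y"
  by (simp add: similarity_def dist_norm)

lemma
  assumes "similarity \<rho> f" "0 \<le> \<rho>" "bounded A"
  shows bounded_similarity_image: "bounded (f ` A)"
    and diameter_similarity_image_le: "diameter (f ` A) \<le> \<rho> * diameter A"
proof -
  have d: "dist (f x) (f y) \<le> \<rho> * diameter A" if "x \<in> A" "y \<in> A" for x y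
    using similarity_dist[OF assms(1)] diameter_bounded_bound[OF assms(3) that] assms(2)
    by (simp add: mult_left_mono)
  show "bounded (f ` A)"
  proof (cases "A = {}")
    case False
    then obtain a where "a \<in> A" by blast
    then have "\<forall>y\<in>f ` A. dist (f a) y \<le> \<rho> * diameter A" using d by blast
    then show ?thesis unfolding bounded_def by blast
  qed simp
  show "diameter (f ` A) \<le> \<rho> * diameter A"
    using assms(2) d
    by (intro diameter_le) (auto simp: dist_norm diameter_ge_0[OF assms(3)])
qed

lemma diam_power_similarity_image_le:
  assumes "similarity \<rho> f" "0 < \<rho>" "bounded A" "0 \<le> s"
  shows "diam_power s (f ` A) \<le> ennreal (\<rho> powr s) * diam_power s A"
proof (cases "A = {} \<or> s = 0")
  case False
  have "diameter (f ` A) powr s \<le> (\<rho> * diameter A) powr s"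
    using assms diameter_similarity_image_le[of \<rho> f A] bounded_similarity_image[of \<rho> f A]
    by (intro powr_mono2) (auto simp: diameter_ge_0)
  also have "\<dots> = \<rho> powr s * diameter A powr s"
    using assms by (simp add: powr_mult diameter_ge_0)
  finally show ?thesis
    using False by (simp add: diam_power_def ennreal_mult[symmetric] ennreal_leI)
qed (use assms(2) in \<open>auto simp: diam_power_def\<close>)

lemma hausdorff_premeasure_similarity_image_le:
  assumes "similarity \<rho> f" "0 < \<rho>" "\<rho> \<le> 1" "0 \<le> s"
  shows "hausdorff_premeasure s d (f ` S) \<le> ennreal (\<rho> powr s) * hausdorff_premeasure s d S"
proof -
  \<comment> \<open>Moving the factor to the left as \<open>\<rho> powr - s\<close> leaves a plain
    infimum over covers of \<open>S\<close> on the right, so the bound can be checked cover by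
    cover.\<close>
  have inv: "ennreal (\<rho> powr s) * ennreal (\<rho> powr - s) = 1"
    using assms(2) by (simp add: ennreal_mult[symmetric] powr_add[symmetric])
  have "ennreal (\<rho> powr - s) * hausdorff_premeasure s d (f ` S) \<le> (\<Sum>i. diam_power s (A i))"
    if A: "A \<in> hausdorff_covers d S" for A
  proof -
    have "diameter (f ` A i) \<le> d" for i
    proof -
      have "\<rho> * diameter (A i) \<le> 1 * diameter (A i)"
        using assms A by (intro mult_right_mono) (auto simp: diameter_ge_0)
      moreover have "diameter (f ` A i) \<le> \<rho> * diameter (A i)"
        using A by (intro diameter_similarity_image_le[OF assms(1)]) (use assms(2) in auto)
      ultimately show ?thesis using A by (auto intro: order_trans)
    qed
    moreover have "f ` S \<subseteq> (\<Union>i. f ` A i)" using A by blast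
    ultimately have "(\<lambda>i. f ` A i) \<in> hausdorff_covers d (f ` S)"
      using A assms(2) by (auto intro: bounded_similarity_image[OF assms(1)])
    then have "hausdorff_premeasure s d (f ` S) \<le> (\<Sum>i. diam_power s (f ` A i))"
      by (rule hausdorff_premeasure_le)
    also have "\<dots> \<le> (\<Sum>i. ennreal (\<rho> powr s) * diam_power s (A i))"
      using A by (intro suminf_le diam_power_similarity_image_le[OF assms(1,2) _ assms(4)]) auto
    also have "\<dots> = ennreal (\<rho> powr s) * (\<Sum>i. diam_power s (A i))" by simp
    finally have "ennreal (\<rho> powr - s) * hausdorff_premeasure s d (f ` S)
        \<le> ennreal (\<rho> powr - s) * (ennreal (\<rho> powr s) * (\<Sum>i. diam_power s (A i)))"
      by (rule mult_left_mono) simp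
    also have "\<dots> = (\<Sum>i. diam_power s (A i))"
      using inv by (simp add: mult.assoc[symmetric] mult.commute)
    finally show ?thesis .
  qed
  then have "ennreal (\<rho> powr - s) * hausdorff_premeasure s d (f ` S) \<le> hausdorff_premeasure s d S"
    unfolding hausdorff_premeasure_def[of s d S] by (intro INF_greatest)
  then have "ennreal (\<rho> powr s) * (ennreal (\<rho> powr - s) * hausdorff_premeasure s d (f ` S))
      \<le> ennreal (\<rho> powr s) * hausdorff_premeasure s d S"
    by (rule mult_left_mono) simp
  then show ?thesis using inv by (simp add: mult.assoc[symmetric])
qed

text \<open>For sets of diameter at most \<open>d\<close> the t-th power is at most
  \<open>d powr (t - s)\<close> times the s-th, so arbitrarily small s-sums give arbitrarily small
  t-sums.\<close>

lemma hausdorff_premeasure_exponent: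
  assumes "0 \<le> s" "s < t" "0 < d" "hausdorff_premeasure s d S = 0"
  shows "hausdorff_premeasure t d S = 0"
proof -
  have "hausdorff_premeasure t d S \<le> ennreal e" if e: "0 < e" for e
  proof -
    have "hausdorff_premeasure s d S < ennreal (e / d powr (t - s))"
      using assms e by simp
    then obtain A where A: "A \<in> hausdorff_covers d S"
        "(\<Sum>i. diam_power s (A i)) < ennreal (e / d powr (t - s))"
      unfolding hausdorff_premeasure_def INF_less_iff by blast
    have "diam_power t (A i) \<le> ennreal (d powr (t - s)) * diam_power s (A i)" for i
    proof (cases "A i = {}")
      case False
      have dm: "0 \<le> diameter (A i)" "diameter (A i) \<le> d"
        using A(1) by (auto simp: diameter_ge_0)
      have "diameter (A i) powr t = diameter (A i) powr (t - s) * diameter (A i) powr s"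
        by (simp add: powr_add[symmetric])
      also have "\<dots> \<le> d powr (t - s) * diameter (A i) powr s"
        using dm assms by (intro mult_right_mono powr_mono2) auto
      finally have "ennreal (diameter (A i) powr t) \<le> ennreal (d powr (t - s)) * ennreal (diameter (A i) powr s)"
        by (simp add: ennreal_mult[symmetric] ennreal_leI)
      \<comment> \<open>This bound is for \<open>s = 0\<close>, where \<open>diam_power\<close> is 1
        even for singletons and does not agree with \<open>diameter (A i) powr 0\<close>.\<close>
      moreover have "ennreal (diameter (A i) powr t) \<le> ennreal (d powr t)"
        using dm assms by (intro ennreal_leI powr_mono2) auto
      ultimately show ?thesis
        using False assms by (auto simp: diam_power_def)
    qed (simp add: diam_power_def)
    then have "(\<Sum>i. diam_power t (A i)) \<le> (\<Sum>i. ennreal (d powr (t - s)) * diam_power s (A i))"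
      by (intro suminf_le) auto
    also have "\<dots> = ennreal (d powr (t - s)) * (\<Sum>i. diam_power s (A i))" by simp
    also have "\<dots> \<le> ennreal (d powr (t - s)) * ennreal (e / d powr (t - s))"
      using A(2) by (intro mult_left_mono) auto
    also have "\<dots> = ennreal e" using assms e by (simp add: ennreal_mult[symmetric])
    finally show ?thesis using hausdorff_premeasure_le[OF A(1), of t] by (rule order_trans[rotated])
  qed
  then have "hausdorff_premeasure t d S \<le> 0 + ennreal e" if "0 < e" for e
    using that by simp
  then have "hausdorff_premeasure t d S \<le> 0"
    by (rule ennreal_le_epsilon)
  then show ?thesis by simp
qed

lemma hausdorff_measure_eq_0_if_dim_less:
  assumes "hausdorff_dim S < ereal t"
  shows "hausdorff_measure t S = 0"
proof -
  obtain s where "0 \<le> s" "s < t" "hausdorff_measure s S = 0"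
    using assms unfolding hausdorff_dim_def Inf_less_iff by auto
  then show ?thesis
    unfolding hausdorff_measure_eq_0_iff using hausdorff_premeasure_exponent[of s t] by blast
qed

text \<open>Arbitrary countable covers are reduced to finite ones by closed balls of positive
  radius: enlarge each set to an open ball at a summable extra cost, then use compactness. A finite
  cover has a smallest radius, so a mass of finite level can resolve it.\<close>

lemma hausdorff_dim_ge:
  fixes S :: "'a::euclidean_space set"
  assumes "compact S" "0 < c" "0 \<le> t"
    and cover: "\<And>(I :: nat set) x \<rho>. finite I \<Longrightarrow> (\<And>i. i \<in> I \<Longrightarrow> 0 < \<rho> i \<and> \<rho> i \<le> 1) \<Longrightarrow>
      S \<subseteq> (\<Union>i\<in>I. cball (x i) (\<rho> i)) \<Longrightarrow> 1 \<le> c * (\<Sum>i\<in>I. \<rho> i powr t)"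
  shows "ereal t \<le> hausdorff_dim S"
proof (rule ccontr)
  assume "\<not> ?thesis"
  then have dim: "hausdorff_dim S < ereal t" by simp
  have t: "0 < t" using dim hausdorff_dim_nonneg[of S] order_le_less_trans by fastforce
  \<comment> \<open>Doubled diameters will cost at most \<open>2 powr t * \<epsilon>\<close> and the
    extra radii at most \<open>\<epsilon>\<close>, so that \<open>c\<close> times the total stays at
    or below one half.\<close>
  define \<epsilon> where "\<epsilon> = min 1 (1 / (2 * c * (2 powr t + 1)))"
  have den: "0 < 2 * c * (2 powr t + 1)" using assms(2) by (intro mult_pos_pos add_pos_pos) auto
  then have \<epsilon>: "0 < \<epsilon>" "\<epsilon> \<le> 1" "\<epsilon> \<le> 1 / (2 * c * (2 powr t + 1))"
    by (auto simp: \<epsilon>_def)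
  \<comment> \<open>Scale one half keeps the doubled diameters at or below 1.\<close>
  have "hausdorff_premeasure t (1 / 2) S < ennreal \<epsilon>"
    using hausdorff_measure_eq_0_if_dim_less[OF dim] \<epsilon>(1) by (simp add: hausdorff_measure_eq_0_iff)
  then obtain A where A: "A \<in> hausdorff_covers (1 / 2) S" "(\<Sum>i. diam_power t (A i)) < ennreal \<epsilon>"
    unfolding hausdorff_premeasure_def INF_less_iff by blast
  \<comment> \<open>These radii take over for sets of diameter 0; their t-th powers form a geometric
    series of sum \<open>\<epsilon>\<close>. Together with the doubling below they make the radius
    exceed the diameter strictly, so open balls suffice.\<close>
  define \<eta> where "\<eta> = (\<lambda>i::nat. (\<epsilon> * (1 / 2) ^ Suc i) powr (1 / t))"
  define \<rho> where "\<rho> = (\<lambda>i. max (2 * diameter (A i)) (\<eta> i))"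
  define a where "a = (\<lambda>i. SOME x. x \<in> A i)"
  have \<eta>0: "0 < \<eta> i" for i using \<epsilon>(1) by (simp add: \<eta>_def)
  have \<eta>1: "\<eta> i \<le> 1" for i
  proof -
    have "\<epsilon> * (1 / 2) ^ Suc i \<le> 1 * 1"
      using \<epsilon> by (intro mult_mono power_le_one) auto
    then show ?thesis
      unfolding \<eta>_def using t \<epsilon> by (intro powr_le1) auto
  qed
  have \<eta>t: "\<eta> i powr t = \<epsilon> * (1 / 2) ^ Suc i" for i
    using t \<epsilon>(1) by (simp add: \<eta>_def powr_powr)
  have \<rho>: "0 < \<rho> i \<and> \<rho> i \<le> 1" for i
    using A(1) \<eta>0[of i] \<eta>1[of i] by (auto simp: \<rho>_def less_max_iff_disj mult.commute)
  have dm: "0 \<le> diameter (A i)" for i using A(1) by (auto simp: diameter_ge_0)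
  have "A i \<subseteq> ball (a i) (\<rho> i)" for i
  proof
    fix x assume x: "x \<in> A i"
    then have "a i \<in> A i" unfolding a_def by (rule someI)
    then have "dist (a i) x \<le> diameter (A i)"
      using A(1) x by (intro diameter_bounded_bound) auto
    also have "\<dots> < \<rho> i" using dm[of i] \<eta>0[of i] by (auto simp: \<rho>_def less_max_iff_disj)
    finally show "x \<in> ball (a i) (\<rho> i)" by simp
  qed
  then have "(\<Union>i. A i) \<subseteq> (\<Union>i. ball (a i) (\<rho> i))" by (intro UN_mono) auto
  then have "S \<subseteq> (\<Union>i\<in>UNIV. ball (a i) (\<rho> i))" using A(1) by blast
  then obtain I where I: "finite I" "S \<subseteq> (\<Union>i\<in>I. ball (a i) (\<rho> i))"
    using compactE_image[OF assms(1), of UNIV "\<lambda>i. ball (a i) (\<rho> i)"] by (metis open_ball)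
  have "(\<Union>i\<in>I. ball (a i) (\<rho> i)) \<subseteq> (\<Union>i\<in>I. cball (a i) (\<rho> i))"
    by (intro UN_mono) auto
  then have one: "1 \<le> c * (\<Sum>i\<in>I. \<rho> i powr t)"
    using I \<rho> by (intro cover[of I \<rho> a]) auto
  have "\<rho> i powr t \<le> 2 powr t * diameter (A i) powr t + \<epsilon> * (1 / 2) ^ Suc i" for i
  proof -
    have "\<rho> i powr t \<le> (2 * diameter (A i)) powr t + \<eta> i powr t"
      unfolding \<rho>_def max_def by simp
    then show ?thesis using dm[of i] \<eta>t[of i] by (simp add: powr_mult)
  qed
  then have "(\<Sum>i\<in>I. \<rho> i powr t)
      \<le> 2 powr t * (\<Sum>i\<in>I. diameter (A i) powr t) + \<epsilon> * (\<Sum>i\<in>I. (1 / 2) ^ Suc i)"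
    unfolding sum_distrib_left sum.distrib[symmetric] by (rule sum_mono)
  also have "(\<Sum>i\<in>I. (1 / 2) ^ Suc i) \<le> (1::real)"
    using sum_le_suminf[of "\<lambda>i. (1 / 2) ^ Suc i :: real" I] power_half_series I(1)
    by (simp add: sums_iff)
  also have "(\<Sum>i\<in>I. diameter (A i) powr t) < \<epsilon>"
  proof -
    have "ennreal (\<Sum>i\<in>I. diameter (A i) powr t) = (\<Sum>i\<in>I. ennreal (diameter (A i) powr t))"
      by simp
    also have "\<dots> \<le> (\<Sum>i\<in>I. diam_power t (A i))"
      using t by (intro sum_mono) (auto simp: diam_power_def)
    also have "\<dots> \<le> (\<Sum>i. diam_power t (A i))"
      using I(1) by (intro sum_le_suminf) auto
    also have "\<dots> < ennreal \<epsilon>" by (rule A(2))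
    finally show ?thesis by (simp add: ennreal_less_iff sum_nonneg)
  qed
  finally have "(\<Sum>i\<in>I. \<rho> i powr t) < 2 powr t * \<epsilon> + \<epsilon> * 1"
    using \<epsilon>(1) by simp
  then have "c * (\<Sum>i\<in>I. \<rho> i powr t) < c * (2 powr t * \<epsilon> + \<epsilon> * 1)"
    using assms(2) by (rule mult_strict_left_mono)
  also have "\<dots> = (c * (2 powr t + 1)) * \<epsilon>" by (simp add: algebra_simps)
  also have "\<dots> \<le> (c * (2 powr t + 1)) * (1 / (2 * c * (2 powr t + 1)))"
    using den \<epsilon>(3) by (intro mult_left_mono) auto
  also have "\<dots> = 1 / 2" using den assms(2) by (simp add: field_simps)
  finally show False using one by simp
qed

section \<open>Upper bounds for the fractal sets\<close>

context ratio_graph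
begin

text \<open>A maximum principle: if the largest quotient \<open>M\<close> of \<open>x\<close> by
  \<open>h\<close> were positive, then at a vertex attaining it A x would be at most
  \<open>M\<close> times A h, which is strictly below \<open>M * h w = x w\<close>.\<close>

lemma nonpos_if_le_transfer:
  assumes h: "subvector G r t h"
    and x: "\<And>v. v \<in> verts G \<Longrightarrow> x v \<le> transfer G r t x v"
    and v: "v \<in> verts G"
  shows "x v \<le> 0"
proof -
  define M where "M = Max ((\<lambda>v. x v / h v) ` verts G)"
  have "M \<in> (\<lambda>v. x v / h v) ` verts G"
    unfolding M_def using v by (intro Max_in) auto
  then obtain w where w: "w \<in> verts G" "M = x w / h w" by blast
  have hpos: "0 < h u" if "u \<in> verts G" for u using h that by (simp add: subvector_def)
  have le: "x u \<le> M * h u" if "u \<in> verts G" for u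
  proof -
    have "x u / h u \<le> M" unfolding M_def using that by (intro Max_ge) auto
    then show ?thesis using hpos[OF that] by (simp add: pos_divide_le_eq)
  qed
  have "M \<le> 0"
  proof (rule ccontr)
    assume "\<not> M \<le> 0"
    then have "0 < M" by simp
    have "M * h w = x w" using w hpos[of w] by simp
    also have "\<dots> \<le> transfer G r t x w" by (rule x[OF w(1)])
    also have "\<dots> \<le> transfer G r t (\<lambda>u. M * h u) w" by (rule transfer_mono) (rule le)
    also have "\<dots> = M * transfer G r t h w"
      by (simp add: transfer_def sum_distrib_left mult_ac)
    also have "\<dots> < M * h w"
      using h w(1) \<open>0 < M\<close> by (simp add: subvector_def)
    finally show False by simp
  qed
  then have "M * h v \<le> 0" using hpos[OF v] by (simp add: mult_le_0_iff)
  then show ?thesis using le[OF v] by linarith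
qed

text \<open>The inserted value keeps both extrema defined and strictly between 0 and 1 for a graph
  without edges.\<close>

definition rmax :: real where "rmax = Max (insert (1 / 2) (r ` arcs G))"
definition rmin :: real where "rmin = Min (insert (1 / 2) (r ` arcs G))"

lemma rmax_pos: "0 < rmax" and rmax_less_1: "rmax < 1"
  and le_rmax: "e \<in> arcs G \<Longrightarrow> r e \<le> rmax"
  and rmin_pos: "0 < rmin" and rmin_less_1: "rmin < 1"
  and rmin_le: "e \<in> arcs G \<Longrightarrow> rmin \<le> r e"
  unfolding rmax_def rmin_def
  by (auto simp: Max_less_iff Min_gr_iff Max_gr_iff Min_less_iff ratio_pos ratio_less_1)

text \<open>Pulling back along an edge enlarges the scale by at least \<open>1 / rmax\<close>, which
  lowers the counter, and takes a scale below 1 no further than \<open>1 / rmin\<close>, which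
  bounds the range of the base case.\<close>

lemma scale_step:
  assumes "e \<in> arcs G" "rmax ^ Suc k \<le> d" "d < 1"
  shows "rmax ^ k \<le> d / r e" "d / r e \<le> 1 / rmin"
proof -
  have "rmax ^ k * r e \<le> rmax ^ k * rmax"
    using rmax_pos le_rmax[OF assms(1)] by (intro mult_left_mono) auto
  then show "rmax ^ k \<le> d / r e"
    using assms(2) ratio_pos[OF assms(1)] by (simp add: pos_le_divide_eq mult.commute)
  show "d / r e \<le> 1 / rmin"
    using assms(3) ratio_pos[OF assms(1)] rmin_le[OF assms(1)] rmin_pos by (intro frac_le) auto
qed

lemma ex_rmax_power_le:
  assumes "0 < d" obtains k where "rmax ^ k \<le> d"
  using real_arch_pow_inv[OF assms rmax_less_1] by (meson less_imp_le)

end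

locale similarity_gdifs = ratio_graph G r
  for G :: "('v, 'e) pre_digraph" and r :: "'e \<Rightarrow> real" +
  fixes C :: "'v \<Rightarrow> 'a::euclidean_space set"
    and f :: "'e \<Rightarrow> 'a \<Rightarrow> 'a"
    and F :: "'v \<Rightarrow> 'a set"
  assumes similarity: "e \<in> arcs G \<Longrightarrow> similarity (r e) (f e)"
    and compact_C: "v \<in> verts G \<Longrightarrow> compact (C v)"
    and nonempty_C: "v \<in> verts G \<Longrightarrow> C v \<noteq> {}"
    and fractal: "gd_fractal G C f F"
begin

lemma F_eq: "v \<in> verts G \<Longrightarrow> F v = (\<Union>e\<in>out_arcs G v. f e ` F (head G e)) \<union> C v"
  and compact_F: "v \<in> verts G \<Longrightarrow> compact (F v)"
  and nonempty_F: "v \<in> verts G \<Longrightarrow> F v \<noteq> {}"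
  using fractal unfolding gd_fractal_def by blast+

lemma C_subset_F: "v \<in> verts G \<Longrightarrow> C v \<subseteq> F v"
  by (subst F_eq) auto

lemma dist_f: "e \<in> arcs G \<Longrightarrow> dist (f e x) (f e y) = r e * dist x y"
  by (rule similarity_dist) (rule similarity)

text \<open>Constants of the shape \<open>K * h u\<close> are reproduced by self-similarity: the
  images of covers at the heads cost \<open>K\<close> times A h, and the slack between A h and
  \<open>h\<close> pays for covering the condensation set.\<close>

lemma box_bounded_F:
  assumes h: "subvector G r t h" and t: "0 \<le> t"
    and C: "\<And>v. v \<in> verts G \<Longrightarrow> box_bounded t (C v)"
    and v: "v \<in> verts G"
  shows "box_bounded t (F v)"
proof -
  have hpos: "0 < h u" and slack: "transfer G r t h u < h u" if "u \<in> verts G" for u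
    using h that by (auto simp: subvector_def)
  have "\<forall>u\<in>verts G. \<exists>K>0. \<forall>d. 0 < d \<and> d \<le> 1 \<longrightarrow>
     (\<exists>P. finite P \<and> real (card P) \<le> K * d powr - t \<and> C u \<subseteq> (\<Union>x\<in>P. cball x d))"
    using C unfolding box_bounded_def by blast
  then obtain L where L: "\<And>u. u \<in> verts G \<Longrightarrow> 0 < L u"
    "\<And>u d. u \<in> verts G \<Longrightarrow> 0 < d \<Longrightarrow> d \<le> 1 \<Longrightarrow>
     \<exists>P. finite P \<and> real (card P) \<le> L u * d powr - t \<and> C u \<subseteq> (\<Union>x\<in>P. cball x d)"
    by metis
  have "\<forall>u\<in>verts G. \<exists>P. finite P \<and> F u \<subseteq> (\<Union>x\<in>P. cball x 1)"
    using finite_cball_cover[OF compact_imp_bounded[OF compact_F] zero_less_one] by metis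
  then obtain Q where Q: "\<And>u. u \<in> verts G \<Longrightarrow> finite (Q u)"
    "\<And>u. u \<in> verts G \<Longrightarrow> F u \<subseteq> (\<Union>x\<in>Q u. cball x 1)"
    by metis
  \<comment> \<open>\<open>a u\<close> is the least \<open>K\<close> whose slack absorbs
    \<open>L u\<close>, and \<open>b u\<close> the least one for which the unit balls
    \<open>Q u\<close> serve at all scales from 1 to \<open>1 / rmin\<close>. The sum over all
    vertices dominates both.\<close>
  define a where "a = (\<lambda>u. L u / (h u - transfer G r t h u))"
  define b where "b = (\<lambda>u. real (card (Q u)) * (1 / rmin) powr t / h u)"
  define K where "K = (\<Sum>u\<in>verts G. a u + b u)"
  have a0: "0 < a u" and b0: "0 \<le> b u" if "u \<in> verts G" for u
    using L(1)[OF that] slack[OF that] hpos[OF that] by (auto simp: a_def b_def)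
  have ab: "a u + b u \<le> K" if "u \<in> verts G" for u
    unfolding K_def
  proof (rule member_le_sum[OF that])
    show "0 \<le> a w + b w" if "w \<in> verts G - {u}" for w
      using a0[of w] b0[of w] that by simp
  qed simp
  have K0: "0 < K" using ab[OF v] a0[OF v] b0[OF v] by linarith
  have Ka: "K * transfer G r t h u + L u \<le> K * h u" if "u \<in> verts G" for u
  proof -
    have "a u \<le> K" using ab[OF that] b0[OF that] by linarith
    then have "L u \<le> K * (h u - transfer G r t h u)"
      using slack[OF that] by (simp add: a_def pos_divide_le_eq)
    then show ?thesis by (simp add: algebra_simps)
  qed
  have base: "\<exists>P. finite P \<and> real (card P) \<le> K * h u * d powr - t \<and> F u \<subseteq> (\<Union>x\<in>P. cball x d)"
    if u: "u \<in> verts G" and d: "1 \<le> d" "d \<le> 1 / rmin" for u d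
  proof (intro exI conjI)
    have dt: "0 < d powr t" using d by simp
    have "b u \<le> K" using ab[OF u] a0[OF u] by linarith
    then have "real (card (Q u)) * (1 / rmin) powr t \<le> K * h u"
      using hpos[OF u] by (simp add: b_def pos_divide_le_eq)
    moreover have "real (card (Q u)) * d powr t \<le> real (card (Q u)) * (1 / rmin) powr t"
      using d t by (intro mult_left_mono powr_mono2) auto
    ultimately have "real (card (Q u)) * d powr t \<le> K * h u" by linarith
    then show "real (card (Q u)) \<le> K * h u * d powr - t"
      using dt by (simp add: powr_minus pos_le_divide_eq divide_inverse[symmetric])
    have "(\<Union>x\<in>Q u. cball x 1) \<subseteq> (\<Union>x\<in>Q u. cball x d)"
      using d by (intro UN_mono subset_cball) auto
    then show "F u \<subseteq> (\<Union>x\<in>Q u. cball x d)" using Q(2)[OF u] by (rule order_trans[rotated])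
  qed (rule Q(1)[OF u])
  have main: "\<exists>P. finite P \<and> real (card P) \<le> K * h u * d powr - t \<and> F u \<subseteq> (\<Union>x\<in>P. cball x d)"
    if "u \<in> verts G" "rmax ^ k \<le> d" "d \<le> 1 / rmin" for k u d
    using that
  proof (induction k arbitrary: u d)
    case 0
    then show ?case using base by simp
  next
    case (Suc k)
    show ?case
    proof (cases "1 \<le> d")
      case True
      then show ?thesis using base Suc.prems by blast
    next
      case False
      then have d1: "d < 1" by simp
      have d0: "0 < d" using Suc.prems(2) zero_less_power[OF rmax_pos, of "Suc k"] by linarith
      have "\<exists>P. finite P \<and> real (card P) \<le> K * h (head G e) * (d / r e) powr - t
          \<and> F (head G e) \<subseteq> (\<Union>x\<in>P. cball x (d / r e))" if "e \<in> out_arcs G u" for e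
        using out_arcs_arcs[OF that] scale_step[of e k d] Suc.prems d1 by (intro Suc.IH) auto
      then obtain P where P: "\<And>e. e \<in> out_arcs G u \<Longrightarrow> finite (P e)"
        "\<And>e. e \<in> out_arcs G u \<Longrightarrow> real (card (P e)) \<le> K * h (head G e) * (d / r e) powr - t"
        "\<And>e. e \<in> out_arcs G u \<Longrightarrow> F (head G e) \<subseteq> (\<Union>x\<in>P e. cball x (d / r e))"
        by metis
      obtain R where R: "finite R" "real (card R) \<le> L u * d powr - t" "C u \<subseteq> (\<Union>x\<in>R. cball x d)"
        using L(2)[OF Suc.prems(1) d0] d1 by auto
      let ?P = "(\<Union>e\<in>out_arcs G u. f e ` P e) \<union> R"
      have fin: "finite ?P" using P(1) R(1) by (auto intro: finite_out_arcs)
      have "f e ` F (head G e) \<subseteq> (\<Union>x\<in>f e ` P e. cball x d)" if e: "e \<in> out_arcs G u" for e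
      proof -
        have "f e ` cball x (d / r e) \<subseteq> cball (f e x) d" for x
          using ratio_pos[OF out_arcs_arcs[OF e]]
          by (auto simp: dist_f[OF out_arcs_arcs[OF e]] pos_le_divide_eq mult.commute)
        then have "(\<Union>x\<in>P e. f e ` cball x (d / r e)) \<subseteq> (\<Union>x\<in>P e. cball (f e x) d)"
          by (rule UN_mono[OF order_refl])
        then show ?thesis
          using image_mono[OF P(3)[OF e], of "f e"] by (simp add: image_UN)
      qed
      then have "(\<Union>e\<in>out_arcs G u. f e ` F (head G e)) \<subseteq> (\<Union>e\<in>out_arcs G u. \<Union>x\<in>f e ` P e. cball x d)"
        by (rule UN_mono[OF order_refl])
      then have cov: "F u \<subseteq> (\<Union>x\<in>?P. cball x d)"
        unfolding F_eq[OF Suc.prems(1)] UN_Un using R(3) by (intro Un_mono) (simp_all only: UN_UN_flatten)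
      have "card ?P \<le> (\<Sum>e\<in>out_arcs G u. card (P e)) + card R"
      proof -
        have "card ?P \<le> card (\<Union>e\<in>out_arcs G u. f e ` P e) + card R" by (rule card_Un_le)
        also have "card (\<Union>e\<in>out_arcs G u. f e ` P e) \<le> (\<Sum>e\<in>out_arcs G u. card (f e ` P e))"
          by (rule card_UN_le) (rule finite_out_arcs)
        also have "\<dots> \<le> (\<Sum>e\<in>out_arcs G u. card (P e))"
          by (intro sum_mono card_image_le P(1))
        finally show ?thesis by simp
      qed
      then have "real (card ?P) \<le> (\<Sum>e\<in>out_arcs G u. real (card (P e))) + real (card R)"
        by (simp flip: of_nat_sum of_nat_add)
      also have "\<dots> \<le> (\<Sum>e\<in>out_arcs G u. K * h (head G e) * (d / r e) powr - t) + L u * d powr - t"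
        by (intro add_mono sum_mono P(2) R(2))
      \<comment> \<open>Rescaling by \<open>1 / r e\<close> releases the factor
        \<open>r e powr t\<close>, which is the entry of the transfer operator.\<close>
      also have "(\<Sum>e\<in>out_arcs G u. K * h (head G e) * (d / r e) powr - t)
          = K * transfer G r t h u * d powr - t"
        unfolding transfer_def sum_distrib_left sum_distrib_right
        using d0 ratio_pos[OF out_arcs_arcs]
        by (intro sum.cong) (auto simp: powr_divide powr_minus divide_simps less_imp_le)
      also have "K * transfer G r t h u * d powr - t + L u * d powr - t
          = (K * transfer G r t h u + L u) * d powr - t" by (simp add: distrib_right)
      also have "\<dots> \<le> K * h u * d powr - t"
        by (intro mult_right_mono Ka Suc.prems) auto
      finally show ?thesis using fin cov by blast
    qed
  qed
  show ?thesis
    unfolding box_bounded_def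
  proof (intro exI[of _ "K * h v"] conjI allI impI)
    show "0 < K * h v" using K0 hpos[OF v] by simp
    fix d :: real assume d: "0 < d \<and> d \<le> 1"
    obtain k where "rmax ^ k \<le> d" using ex_rmax_power_le d by blast
    moreover have "d \<le> 1 / rmin"
      using d rmin_pos rmin_less_1 by (simp add: pos_le_divide_eq mult_le_one less_imp_le)
    ultimately show "\<exists>P. finite P \<and> real (card P) \<le> K * h v * d powr - t \<and> F v \<subseteq> (\<Union>x\<in>P. cball x d)"
      by (intro main v)
  qed
qed

text \<open>At a fixed scale \<open>d\<close> the premeasures of the fractal sets form a finite
  vector \<open>x\<close> with \<open>x \<le> A x\<close>, because the condensation sets contribute
  nothing; the maximum principle forces it to vanish.\<close>

lemma hausdorff_measure_F_eq_0:
  assumes h: "subvector G r t h" and t: "0 \<le> t"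
    and C: "\<And>v. v \<in> verts G \<Longrightarrow> hausdorff_measure t (C v) = 0"
    and v: "v \<in> verts G"
  shows "hausdorff_measure t (F v) = 0"
  unfolding hausdorff_measure_eq_0_iff
proof (intro allI impI)
  fix d :: real assume d: "0 < d"
  define x where "x = (\<lambda>u. enn2real (hausdorff_premeasure t d (F u)))"
  have fin: "hausdorff_premeasure t d (F u) = ennreal (x u)" if "u \<in> verts G" for u
    using hausdorff_premeasure_finite[OF compact_imp_bounded[OF compact_F[OF that]] d]
    by (simp add: x_def)
  have "x u \<le> transfer G r t x u" if u: "u \<in> verts G" for u
  proof -
    have "ennreal (x u) = hausdorff_premeasure t d ((\<Union>e\<in>out_arcs G u. f e ` F (head G e)) \<union> C u)"
      using fin[OF u] F_eq[OF u] by simp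
    also have "\<dots> \<le> hausdorff_premeasure t d (\<Union>e\<in>out_arcs G u. f e ` F (head G e)) + 0"
    proof -
      have "hausdorff_premeasure t d (C u) = 0"
        using C[OF u] d unfolding hausdorff_measure_eq_0_iff by simp
      then show ?thesis
        using hausdorff_premeasure_Un[of t d "\<Union>e\<in>out_arcs G u. f e ` F (head G e)" "C u"] by simp
    qed
    also have "\<dots> \<le> (\<Sum>e\<in>out_arcs G u. hausdorff_premeasure t d (f e ` F (head G e)))"
      using hausdorff_premeasure_UN[OF finite_out_arcs d] by simp
    also have "\<dots> \<le> (\<Sum>e\<in>out_arcs G u. ennreal (r e powr t) * hausdorff_premeasure t d (F (head G e)))"
      using out_arcs_arcs t
      by (intro sum_mono hausdorff_premeasure_similarity_image_le similarity)
        (auto intro: ratio_pos ratio_less_1 less_imp_le)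
    also have "\<dots> = (\<Sum>e\<in>out_arcs G u. ennreal (r e powr t * x (head G e)))"
    proof (rule sum.cong[OF refl])
      fix e assume "e \<in> out_arcs G u"
      then show "ennreal (r e powr t) * hausdorff_premeasure t d (F (head G e)) = ennreal (r e powr t * x (head G e))"
        using fin[of "head G e"] out_arcs_arcs by (simp add: ennreal_mult x_def)
    qed
    also have "\<dots> = ennreal (transfer G r t x u)"
      unfolding transfer_def by (intro sum_ennreal) (simp add: x_def)
    finally show ?thesis
      by (subst (asm) ennreal_le_iff) (auto simp: transfer_def x_def intro!: sum_nonneg)
  qed
  then have "x v \<le> 0" by (rule nonpos_if_le_transfer[OF h _ v])
  then show "hausdorff_premeasure t d (F v) = 0"
    using fin[OF v] by (simp add: ennreal_neg)
qed

lemma upper_box_dim_F_le: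
  assumes "subvector G r t h" "0 \<le> t"
    "\<And>v. v \<in> verts G \<Longrightarrow> upper_box_dim (C v) < ereal t" "v \<in> verts G"
  shows "upper_box_dim (F v) \<le> ereal t"
  using assms compact_imp_bounded[OF compact_F] compact_imp_bounded[OF compact_C] nonempty_F
  by (intro upper_box_dim_le_if_box_bounded box_bounded_F box_bounded_if_upper_box_dim_less) auto

lemma hausdorff_dim_F_le:
  assumes "subvector G r t h" "0 \<le> t"
    "\<And>v. v \<in> verts G \<Longrightarrow> hausdorff_dim (C v) < ereal t" "v \<in> verts G"
  shows "hausdorff_dim (F v) \<le> ereal t"
  using assms
  by (intro hausdorff_dim_le hausdorff_measure_F_eq_0 hausdorff_measure_eq_0_if_dim_less) auto

end

section \<open>Lower bounds under the open set condition\<close>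

text \<open>Removing the translation and the ratio leaves an isometry fixing 0, hence an orthogonal
  map. Surjectivity and openness then follow from linear algebra.\<close>

lemma similarity_decomposition:
  fixes f :: "'a::euclidean_space \<Rightarrow> 'a"
  assumes "similarity \<rho> f" "0 < \<rho>"
  obtains T where "linear T" "surj T" "f = (\<lambda>x. f 0 + T x)"
proof
  define T where "T = (\<lambda>x. (f x - f 0) /\<^sub>R \<rho>)"
  have "dist (T x) (T y) = dist x y" for x y
  proof -
    have "T x - T y = (f x - f y) /\<^sub>R \<rho>" by (simp add: T_def algebra_simps)
    then show ?thesis using assms by (simp add: dist_norm similarity_def)
  qed
  then have T: "orthogonal_transformation T"
    unfolding orthogonal_transformation_isometry by (simp add: T_def)
  have eq: "f x - f 0 = \<rho> *\<^sub>R T x" for x using assms(2) by (simp add: T_def)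
  show "linear (\<lambda>x. \<rho> *\<^sub>R T x)"
    using orthogonal_transformation_linear[OF T] by (rule linear_compose_scale_right)
  have "surj (\<lambda>x :: 'a. \<rho> *\<^sub>R x)"
    using assms(2) by (intro surjI[of _ "\<lambda>x. x /\<^sub>R \<rho>"]) simp
  then have "surj ((\<lambda>x. \<rho> *\<^sub>R x) \<circ> T)"
    using orthogonal_transformation_surj[OF T] by (rule comp_surj[rotated])
  then show "surj (\<lambda>x. \<rho> *\<^sub>R T x)" by (simp add: o_def)
  show "f = (\<lambda>x. f 0 + \<rho> *\<^sub>R T x)"
    using eq by (simp add: fun_eq_iff flip: eq)
qed

lemma similarity_surj:
  fixes f :: "'a::euclidean_space \<Rightarrow> 'a"
  assumes "similarity \<rho> f" "0 < \<rho>"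
  shows "surj f"
proof -
  obtain T where T: "linear T" "surj T" "f = (\<lambda>x. f 0 + T x)"
    using similarity_decomposition[OF assms] .
  have "\<exists>x. f x = y" for y
  proof -
    obtain x where "T x = y - f 0" using T(2) by (metis surjD)
    then have "f x = y" by (subst T(3)) simp
    then show ?thesis ..
  qed
  then show ?thesis by (metis surj_def)
qed

lemma similarity_open_image:
  fixes f :: "'a::euclidean_space \<Rightarrow> 'a"
  assumes "similarity \<rho> f" "0 < \<rho>" "open S"
  shows "open (f ` S)"
proof -
  obtain T where T: "linear T" "surj T" "f = (\<lambda>x. f 0 + T x)"
    using similarity_decomposition[OF assms(1,2)] .
  have "open ((+) (f 0) ` (T ` S))"
    using assms(3) T(1,2) by (intro open_translation open_surjective_linear_image)
  moreover have "f ` S = (+) (f 0) ` (T ` S)"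
    by (subst T(3)) (simp add: image_image)
  ultimately show ?thesis by simp
qed

lemma similarity_inj: "similarity \<rho> f \<Longrightarrow> 0 < \<rho> \<Longrightarrow> inj f"
  by (rule injI) (metis similarity_dist dist_eq_0_iff mult_eq_0_iff less_irrefl)

lemma similarity_image_ball:
  fixes f :: "'a::euclidean_space \<Rightarrow> 'a"
  assumes "similarity \<rho> f" "0 < \<rho>"
  shows "f ` ball a d = ball (f a) (\<rho> * d)"
proof
  show "f ` ball a d \<subseteq> ball (f a) (\<rho> * d)"
    using assms(2) by (auto simp: similarity_dist[OF assms(1)])
  show "ball (f a) (\<rho> * d) \<subseteq> f ` ball a d"
  proof
    fix y assume y: "y \<in> ball (f a) (\<rho> * d)"
    obtain x where "y = f x" using similarity_surj[OF assms] by (metis surjD)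
    then show "y \<in> f ` ball a d"
      using y assms(2) by (auto simp: similarity_dist[OF assms(1)])
  qed
qed

text \<open>The volume is compared through a Vitali covering by balls: the library proves
  rotation invariance of Lebesgue measure only for well-ordered index types.\<close>

lemma emeasure_similarity_image_ge:
  fixes f :: "'a::euclidean_space \<Rightarrow> 'a"
  assumes f: "similarity \<rho> f" "0 < \<rho>" and S: "open S"
  shows "ennreal (\<rho> ^ DIM('a)) * emeasure lborel S \<le> emeasure lborel (f ` S)"
proof -
  let ?B = "\<lambda>p :: 'a \<times> real. ball (fst p) (snd p)"
  define K where "K = {p. 0 < snd p \<and> ?B p \<subseteq> S}"
  have "\<exists>p. p \<in> K \<and> x \<in> ?B p \<and> snd p < d" if x: "x \<in> S" and d: "0 < d" for x d
  proof -
    obtain e where "0 < e" "ball x e \<subseteq> S" using S x openE by blast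
    then show ?thesis
      using d subset_ball[of "min e (d / 2)" e x]
      by (intro exI[of _ "(x, min e (d / 2))"]) (auto simp: K_def)
  qed
  then obtain P where P: "countable P" "P \<subseteq> K"
     "pairwise (\<lambda>i j. disjnt (?B i) (?B j)) P" "negligible (S - (\<Union>i\<in>P. ?B i))"
    by (rule Vitali_covering_theorem_balls[of S K fst snd])
  have disj: "disjoint_family_on ?B P"
    using P(3) by (auto simp: disjoint_family_on_def pairwise_def disjnt_def)
  have disj_f: "disjoint_family_on (\<lambda>p. f ` ?B p) P"
    unfolding disjoint_family_on_def
  proof (intro ballI impI)
    fix p q assume "p \<in> P" "q \<in> P" "p \<noteq> q"
    then have "?B p \<inter> ?B q = {}" using disj by (auto simp: disjoint_family_on_def)
    then show "f ` ?B p \<inter> f ` ?B q = {}"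
      using image_Int[OF similarity_inj[OF f], of "?B p" "?B q"] by simp
  qed
  have sub: "(\<Union>p\<in>P. ?B p) \<subseteq> S" using P(2) by (auto simp: K_def)
  have "emeasure lborel S = emeasure lborel (S - (S - (\<Union>p\<in>P. ?B p)))"
  proof (rule emeasure_Diff_null_set[symmetric])
    have "S - (\<Union>p\<in>P. ?B p) \<in> sets lborel"
      using S by (simp add: sets.Diff borel_open open_UN)
    then show "S - (\<Union>p\<in>P. ?B p) \<in> null_sets lborel"
      using P(4) by (simp add: negligible_iff_null_sets null_sets_completion_iff)
  qed (use S in auto)
  also have "S - (S - (\<Union>p\<in>P. ?B p)) = (\<Union>p\<in>P. ?B p)" using sub by blast
  also have "emeasure lborel (\<Union>p\<in>P. ?B p) = (\<integral>\<^sup>+p. emeasure lborel (?B p) \<partial>count_space P)"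
    using P(1) disj by (intro emeasure_UN_countable) auto
  finally have "ennreal (\<rho> ^ DIM('a)) * emeasure lborel S
      = (\<integral>\<^sup>+p. ennreal (\<rho> ^ DIM('a)) * emeasure lborel (?B p) \<partial>count_space P)"
    by (simp add: nn_integral_cmult)
  also have "\<dots> = (\<integral>\<^sup>+p. emeasure lborel (f ` ?B p) \<partial>count_space P)"
  proof (rule nn_integral_cong)
    fix p assume "p \<in> space (count_space P)"
    then have "0 < snd p" using P(2) by (auto simp: K_def)
    then show "ennreal (\<rho> ^ DIM('a)) * emeasure lborel (?B p) = emeasure lborel (f ` ?B p)"
      using f(2) unfolding similarity_image_ball[OF f]
      by (simp add: emeasure_ball ennreal_mult[symmetric] power_mult_distrib mult_ac)
  qed
  also have "\<dots> = emeasure lborel (\<Union>p\<in>P. f ` ?B p)"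
    using P(1) disj_f similarity_open_image[OF f]
    by (intro emeasure_UN_countable[symmetric]) auto
  \<comment> \<open>The image of the null set left over by the Vitali covering is dropped, so this
    is a lower bound only, which is the direction that the mass estimate uses.\<close>
  also have "\<dots> \<le> emeasure lborel (f ` S)"
    using sub similarity_open_image[OF f S] by (intro emeasure_mono) auto
  finally show ?thesis .
qed

lemma emeasure_lborel_finite_if_bounded:
  fixes S :: "'a::euclidean_space set"
  assumes "bounded S"
  shows "emeasure lborel S \<noteq> \<infinity>"
  using emeasure_bounded_finite[OF assms] by auto

lemma measure_similarity_image_ge:
  fixes f :: "'a::euclidean_space \<Rightarrow> 'a"
  assumes f: "similarity \<rho> f" "0 < \<rho>" and S: "open S" "bounded S"
  shows "\<rho> ^ DIM('a) * measure lborel S \<le> measure lborel (f ` S)"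
proof -
  have "emeasure lborel (f ` S) \<noteq> \<infinity>"
    using f S(2) by (intro emeasure_lborel_finite_if_bounded bounded_similarity_image[OF f(1)]) auto
  moreover have "emeasure lborel S \<noteq> \<infinity>"
    using S(2) by (rule emeasure_lborel_finite_if_bounded)
  moreover note emeasure_similarity_image_ge[OF f S(1)]
  ultimately show ?thesis
    using f(2) by (simp add: emeasure_eq_ennreal_measure ennreal_mult[symmetric] ennreal_le_iff)
qed

section \<open>Mass distributions of finite level on the fractal sets\<close>

locale osc_gdifs = similarity_gdifs G r C f F
  for G :: "('v, 'e) pre_digraph" and r and C :: "'v \<Rightarrow> 'a::euclidean_space set" and f F +
  fixes U :: "'v \<Rightarrow> 'a set" and h :: "'v \<Rightarrow> real" and t :: real
  assumes open_U: "v \<in> verts G \<Longrightarrow> open (U v)"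
    and bounded_U: "v \<in> verts G \<Longrightarrow> bounded (U v)"
    and nonempty_U: "v \<in> verts G \<Longrightarrow> U v \<noteq> {}"
    and image_U: "e \<in> arcs G \<Longrightarrow> f e ` U (head G e) \<subseteq> U (tail G e)"
    and disjoint_U: "e \<in> arcs G \<Longrightarrow> e' \<in> arcs G \<Longrightarrow> e \<noteq> e' \<Longrightarrow> tail G e = tail G e' \<Longrightarrow>
      f e ` U (head G e) \<inter> f e' ` U (head G e') = {}"
    and C_closure: "v \<in> verts G \<Longrightarrow> C v \<subseteq> closure (U v)"
    and super: "supervector G r t h"
    and t_nonneg: "0 \<le> t"
begin

lemma h_pos: "v \<in> verts G \<Longrightarrow> 0 < h v"
  and h_less_transfer: "v \<in> verts G \<Longrightarrow> h v < transfer G r t h v"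
  using super by (auto simp: supervector_def)

text \<open>A Doob transform of the transfer operator by \<open>h\<close>. As \<open>h\<close> is
  not an eigenvector, the normaliser at the tail is A h rather than \<open>h\<close>, so that the
  weights sum to 1.\<close>

definition weight :: "'e \<Rightarrow> real" where
  "weight e = r e powr t * h (head G e) / transfer G r t h (tail G e)"

text \<open>The distribution after \<open>k\<close> steps of the random walk that follows an edge \<open>e\<close> with
  probability \<^term>\<open>weight e\<close>, started at a point of the condensation set; finite levels suffice,
  so that no limit measure is needed.\<close>

primrec mass :: "nat \<Rightarrow> 'v \<Rightarrow> 'a set \<Rightarrow> real" where
  "mass 0 v A = indicator A (SOME x. x \<in> C v)"
| "mass (Suc k) v A = (\<Sum>e\<in>out_arcs G v. weight e * mass k (head G e) (f e -` A))"

lemma weight_nonneg: "e \<in> arcs G \<Longrightarrow> 0 \<le> weight e"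
  using h_pos[of "head G e"] h_pos[of "tail G e"] h_less_transfer[of "tail G e"]
  by (simp add: weight_def)

lemma sum_weight: "v \<in> verts G \<Longrightarrow> (\<Sum>e\<in>out_arcs G v. weight e) = 1"
proof -
  assume v: "v \<in> verts G"
  have "(\<Sum>e\<in>out_arcs G v. weight e)
      = (\<Sum>e\<in>out_arcs G v. r e powr t * h (head G e) / transfer G r t h v)"
    by (intro sum.cong) (auto simp: weight_def)
  also have "\<dots> = transfer G r t h v / transfer G r t h v"
    unfolding sum_divide_distrib[symmetric] by (simp add: transfer_def)
  finally show ?thesis using h_pos[OF v] h_less_transfer[OF v] by simp
qed

text \<open>Here the supervector inequality pays off: the normaliser A h exceeds \<open>h\<close>,
  so replacing it by \<open>h\<close> only increases the right-hand side.\<close>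

lemma h_mult_weight_le: "e \<in> arcs G \<Longrightarrow> h (tail G e) * weight e \<le> r e powr t * h (head G e)"
proof -
  assume e: "e \<in> arcs G"
  have "h (tail G e) * (r e powr t * h (head G e)) \<le> transfer G r t h (tail G e) * (r e powr t * h (head G e))"
    using h_less_transfer[of "tail G e"] h_pos[of "head G e"] e by (intro mult_right_mono) auto
  then show ?thesis
    using h_less_transfer[of "tail G e"] h_pos[of "tail G e"] e
    by (simp add: weight_def pos_divide_le_eq mult_ac)
qed

lemma mass_nonneg: "v \<in> verts G \<Longrightarrow> 0 \<le> mass k v A"
  by (induction k arbitrary: v A)
    (auto intro!: sum_nonneg mult_nonneg_nonneg weight_nonneg simp: out_arcs_arcs)

lemma mass_mono: "v \<in> verts G \<Longrightarrow> A \<subseteq> B \<Longrightarrow> mass k v A \<le> mass k v B"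
proof (induction k arbitrary: v A B)
  case (Suc k)
  show ?case
    unfolding mass.simps
    using Suc.prems(2) by (intro sum_mono mult_left_mono Suc.IH) (auto simp: out_arcs_arcs weight_nonneg)
qed (auto simp: indicator_def)

lemma mass_Un: "v \<in> verts G \<Longrightarrow> mass k v (A \<union> B) \<le> mass k v A + mass k v B"
proof (induction k arbitrary: v A B)
  case (Suc k)
  have "mass (Suc k) v (A \<union> B) \<le> (\<Sum>e\<in>out_arcs G v.
      weight e * (mass k (head G e) (f e -` A) + mass k (head G e) (f e -` B)))"
    unfolding mass.simps vimage_Un
    by (intro sum_mono mult_left_mono Suc.IH) (auto simp: out_arcs_arcs weight_nonneg)
  then show ?case by (simp add: distrib_left sum.distrib)
qed (auto simp: indicator_def)

lemma mass_empty: "mass k v {} = 0"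
  by (induction k arbitrary: v) auto

lemma mass_UN:
  assumes "v \<in> verts G" "finite I"
  shows "mass k v (\<Union>i\<in>I. A i) \<le> (\<Sum>i\<in>I. mass k v (A i))"
  using assms(2)
proof induction
  case (insert i I)
  then show ?case using mass_Un[OF assms(1), of k "A i" "\<Union>i\<in>I. A i"] by simp
qed (simp add: mass_empty)

lemma some_C: "v \<in> verts G \<Longrightarrow> (SOME x. x \<in> C v) \<in> C v"
  using nonempty_C by (simp add: some_in_eq)

text \<open>The walk starts in the condensation set, inside the fractal set, and the edge maps carry
  fractal sets into fractal sets; hence every level is concentrated there.\<close>

lemma mass_eq_1: "v \<in> verts G \<Longrightarrow> F v \<subseteq> A \<Longrightarrow> mass k v A = 1"
proof (induction k arbitrary: v A)
  case 0
  then show ?case using some_C[OF 0(1)] C_subset_F[OF 0(1)] by (auto simp: indicator_def)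
next
  case (Suc k)
  have "mass k (head G e) (f e -` A) = 1" if e: "e \<in> out_arcs G v" for e
  proof (rule Suc.IH)
    show "head G e \<in> verts G" using out_arcs_arcs[OF e] by simp
    have "f e ` F (head G e) \<subseteq> F v" unfolding F_eq[OF Suc.prems(1)] using e by blast
    then show "F (head G e) \<subseteq> f e -` A" using Suc.prems(2) by blast
  qed
  then show ?case using sum_weight[OF Suc.prems(1)] by simp
qed

lemma mass_le_1: "v \<in> verts G \<Longrightarrow> mass k v A \<le> 1"
  using mass_mono[of v A UNIV k] mass_eq_1[of v UNIV k] by simp

lemma image_closure_U: "e \<in> arcs G \<Longrightarrow> f e ` closure (U (head G e)) \<subseteq> closure (U (tail G e))"
proof -
  assume e: "e \<in> arcs G"
  have "(r e)-lipschitz_on UNIV (f e)"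
    using dist_f[OF e] ratio_pos[OF e] by (intro lipschitz_onI) auto
  then have "continuous_on UNIV (f e)" by (rule lipschitz_on_continuous_on)
  then have "continuous_on (closure (U (head G e))) (f e)" by (rule continuous_on_subset) simp
  then show ?thesis
    using image_U[OF e] closure_subset[of "U (tail G e)"]
    by (intro image_closure_subset) auto
qed

text \<open>The third clause of the open set condition puts the starting point into the closure of
  \<open>U v\<close>, and the edge maps preserve these closures.\<close>

lemma mass_eq_0: "v \<in> verts G \<Longrightarrow> A \<inter> closure (U v) = {} \<Longrightarrow> mass k v A = 0"
proof (induction k arbitrary: v A)
  case 0
  then show ?case using some_C[OF 0(1)] C_closure[OF 0(1)] by (auto simp: indicator_def)
next
  case (Suc k)
  have "mass k (head G e) (f e -` A) = 0" if e: "e \<in> out_arcs G v" for e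
  proof (rule Suc.IH)
    show "head G e \<in> verts G" using out_arcs_arcs[OF e] by simp
    have "f e ` closure (U (head G e)) \<subseteq> closure (U v)"
      using image_closure_U[OF out_arcs_arcs[OF e]] e by simp
    then show "f e -` A \<inter> closure (U (head G e)) = {}" using Suc.prems(2) by blast
  qed
  then show ?case by simp
qed

lemma measure_U_pos: "v \<in> verts G \<Longrightarrow> 0 < measure lborel (U v)"
proof -
  assume v: "v \<in> verts G"
  obtain x e where "0 < e" "ball x e \<subseteq> U v"
    using open_U[OF v] nonempty_U[OF v] by (meson all_not_in_conv openE)
  moreover have "measure lborel (ball x e) \<le> measure lborel (U v)" if "ball x e \<subseteq> U v" for x e
    using that open_U[OF v] emeasure_bounded_finite[OF bounded_U[OF v]]
    by (intro measure_mono_fmeasurable) (auto simp: fmeasurable_def)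
  moreover have "0 < measure lborel (ball x e)" if "0 < e" for e
    using that by (simp add: content_ball unit_ball_vol_pos)
  ultimately show ?thesis by (meson less_le_trans)
qed

text \<open>Comparing the mass of a ball with the volume of \<^term>\<open>U v\<close> in a concentric larger ball,
  which is superadditive over the disjoint images of the sets \<^term>\<open>U\<close>, makes the induction on
  the level pass through.\<close>

lemma mass_cball_le_volume:
  obtains c R where "0 < c" "0 < R"
    "\<And>k v x d. v \<in> verts G \<Longrightarrow> rmax ^ k \<le> d \<Longrightarrow> d \<le> 1 / rmin \<Longrightarrow>
      h v * mass k v (cball x d)
        \<le> c * d powr (t - DIM('a)) * measure lborel (U v \<inter> ball x (R * d))"
proof -
  let ?n = "real DIM('a)"
  have "bounded (\<Union>v\<in>verts G. U v)" using bounded_U by (intro bounded_UN) auto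
  then obtain B where B: "0 < B" "\<And>v. v \<in> verts G \<Longrightarrow> U v \<subseteq> ball 0 B"
    using bounded_subset_ballD[of "\<Union>v\<in>verts G. U v" 0] by blast
  \<comment> \<open>A ball of radius \<open>d \<ge> 1\<close> that meets the closure of
    \<open>U v\<close> has its centre within \<open>d + 2 * B \<le> R * d\<close> of every point of
    \<open>U v\<close>, so the larger ball swallows \<open>U v\<close>.\<close>
  define R where "R = 2 + 2 * B"
  \<comment> \<open>For scales from 1 to \<open>1 / rmin\<close> the power
    \<open>d powr (t - ?n)\<close> is at least \<open>rmin powr ?n\<close>, so any constant above
    \<open>a v\<close> bounds even the full mass \<open>h v\<close>.\<close>
  define a where "a = (\<lambda>v. h v * (1 / rmin) powr ?n / measure lborel (U v))"
  define c where "c = 1 + (\<Sum>v\<in>verts G. a v)"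
  have a0: "0 \<le> a v" if "v \<in> verts G" for v
    using h_pos[OF that] by (simp add: a_def)
  have ac: "a v \<le> c" if "v \<in> verts G" for v
    using member_le_sum[of v "verts G" a] that a0 by (simp add: c_def)
  have c: "0 < c" using a0 by (auto simp: c_def intro!: add_pos_nonneg sum_nonneg)
  have base: "h v * mass k v (cball x d) \<le> c * d powr (t - ?n) * measure lborel (U v \<inter> ball x (R * d))"
    if v: "v \<in> verts G" and d: "1 \<le> d" "d \<le> 1 / rmin" for k v x d
  proof (cases "cball x d \<inter> closure (U v) = {}")
    case True
    then show ?thesis using mass_eq_0[OF v True] c by simp
  next
    case False
    then obtain y where y: "dist x y \<le> d" "y \<in> closure (U v)" by auto
    have "closure (U v) \<subseteq> cball 0 B" using B(2)[OF v] by (intro closure_minimal) auto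
    then have y0: "dist y 0 \<le> B" using y(2) by (auto simp: dist_commute)
    have "U v \<subseteq> ball x (R * d)"
    proof
      fix z assume "z \<in> U v"
      then have "dist 0 z < B" using B(2)[OF v] by auto
      moreover have "dist x z \<le> dist x y + dist y 0 + dist 0 z"
        using dist_triangle[of x z y] dist_triangle[of y z 0] by linarith
      ultimately have "dist x z < d + B + B" using y(1) y0 by linarith
      also have "\<dots> \<le> R * d"
      proof -
        have "B * 1 \<le> B * d" using B(1) d by (intro mult_left_mono) auto
        then show ?thesis using d by (simp add: R_def algebra_simps)
      qed
      finally show "z \<in> ball x (R * d)" by simp
    qed
    then have eq: "U v \<inter> ball x (R * d) = U v" by blast
    have "a v \<le> c * (d powr t * ((1 / rmin) powr ?n / d powr ?n))"
    proof -
      have "1 \<le> d powr t" using d t_nonneg by (simp add: ge_one_powr_ge_zero)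
      moreover have "d powr ?n \<le> (1 / rmin) powr ?n" using d by (intro powr_mono2) auto
      then have "1 \<le> (1 / rmin) powr ?n / d powr ?n" using d by (simp add: pos_le_divide_eq)
      ultimately have "1 * 1 \<le> d powr t * ((1 / rmin) powr ?n / d powr ?n)"
        by (intro mult_mono) auto
      then have "c * 1 \<le> c * (d powr t * ((1 / rmin) powr ?n / d powr ?n))"
        using c by (intro mult_left_mono) auto
      then show ?thesis using ac[OF v] by linarith
    qed
    also have "\<dots> = c * d powr (t - ?n) * (1 / rmin) powr ?n" by (simp add: powr_diff)
    finally have "h v / measure lborel (U v) * (1 / rmin) powr ?n \<le> c * d powr (t - ?n) * (1 / rmin) powr ?n"
      by (simp add: a_def)
    then have "h v / measure lborel (U v) \<le> c * d powr (t - ?n)"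
      by (rule mult_right_le_imp_le) (use rmin_pos in simp)
    then have "h v \<le> c * d powr (t - ?n) * measure lborel (U v)"
      using measure_U_pos[OF v] by (simp add: pos_divide_le_eq)
    moreover have "h v * mass k v (cball x d) \<le> h v"
      using mass_le_1[OF v] h_pos[OF v] by simp
    ultimately show ?thesis unfolding eq by linarith
  qed
  have main: "h v * mass k v (cball x d) \<le> c * d powr (t - ?n) * measure lborel (U v \<inter> ball x (R * d))"
    if "v \<in> verts G" "rmax ^ k \<le> d" "d \<le> 1 / rmin" for k v x d
    using that
  proof (induction k arbitrary: v x d)
    case 0
    then show ?case using base[of v d 0 x] by simp
  next
    case (Suc k)
    note v = Suc.prems(1)
    show ?case
    proof (cases "1 \<le> d")
      case True
      then show ?thesis using base v Suc.prems by blast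
    next
      case False
      then have d1: "d < 1" by simp
      have d0: "0 < d" using Suc.prems(2) zero_less_power[OF rmax_pos, of "Suc k"] by linarith
      have "\<exists>y. f e y = x" if "e \<in> arcs G" for e
        using similarity_surj[OF similarity ratio_pos, of e] that by (metis surjD)
      then obtain y where y: "\<And>e. e \<in> arcs G \<Longrightarrow> f e (y e) = x" by metis
      \<comment> \<open>The part of \<open>U\<close> that the induction hypothesis sees along
        \<open>e\<close>. Since \<open>f e\<close> maps the ball about \<open>y e\<close> onto
        \<open>ball x (R * d)\<close>, the images are disjoint parts of
        \<open>U v \<inter> ball x (R * d)\<close>.\<close>
      define S where "S = (\<lambda>e. U (head G e) \<inter> ball (y e) (R * (d / r e)))"
      have S: "open (S e)" "bounded (S e)" if "e \<in> arcs G" for e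
        using open_U[of "head G e"] bounded_U[of "head G e"] that by (auto simp: S_def)
      have step: "h v * (weight e * mass k (head G e) (f e -` cball x d))
          \<le> c * d powr (t - ?n) * measure lborel (f e ` S e)" if eo: "e \<in> out_arcs G v" for e
      proof -
        have e: "e \<in> arcs G" using eo by (rule out_arcs_arcs)
        have tl: "tail G e = v" using eo by simp
        note r0 = ratio_pos[OF e]
        have "f e -` cball x d \<subseteq> cball (y e) (d / r e)"
          using r0 dist_f[OF e, of "y e"] y[OF e] by (auto simp: pos_le_divide_eq mult.commute)
        then have "mass k (head G e) (f e -` cball x d) \<le> mass k (head G e) (cball (y e) (d / r e))"
          using e by (intro mass_mono) auto
        then have "(h v * weight e) * mass k (head G e) (f e -` cball x d)
            \<le> (r e powr t * h (head G e)) * mass k (head G e) (cball (y e) (d / r e))"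
          by (rule mult_mono[OF h_mult_weight_le[OF e, unfolded tl]])
            (use e h_pos[of "head G e"] in \<open>auto simp: mass_nonneg less_imp_le\<close>)
        also have "\<dots> = r e powr t * (h (head G e) * mass k (head G e) (cball (y e) (d / r e)))"
          by simp
        also have "\<dots> \<le> r e powr t * (c * (d / r e) powr (t - ?n) * measure lborel (S e))"
          unfolding S_def using e scale_step[OF e Suc.prems(2) d1]
          by (intro mult_left_mono Suc.IH) auto
        also have "\<dots> = c * d powr (t - ?n) * (r e ^ DIM('a) * measure lborel (S e))"
        proof -
          \<comment> \<open>The exponent \<open>t - ?n\<close> is chosen for this cancellation: what
            remains of the ratio is the factor by which \<open>f e\<close> scales volume.\<close>
          have "r e powr t * (d / r e) powr (t - ?n) = d powr (t - ?n) * r e powr ?n"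
            using r0 d0 by (simp add: powr_divide powr_diff field_simps)
          then show ?thesis using r0 by (simp add: powr_realpow mult_ac)
        qed
        also have "\<dots> \<le> c * d powr (t - ?n) * measure lborel (f e ` S e)"
          using c measure_similarity_image_ge[OF similarity[OF e] r0 S[OF e]]
          by (intro mult_left_mono) auto
        finally show ?thesis by (simp add: mult.assoc)
      qed
      have "h v * mass (Suc k) v (cball x d)
          \<le> (\<Sum>e\<in>out_arcs G v. c * d powr (t - ?n) * measure lborel (f e ` S e))"
        unfolding mass.simps sum_distrib_left by (intro sum_mono step)
      also have "\<dots> = c * d powr (t - ?n) * (\<Sum>e\<in>out_arcs G v. measure lborel (f e ` S e))"
        by (simp add: sum_distrib_left)
      also have "(\<Sum>e\<in>out_arcs G v. measure lborel (f e ` S e)) = measure lborel (\<Union>e\<in>out_arcs G v. f e ` S e)"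
      proof (rule measure_finite_Union[symmetric])
        show "(\<lambda>e. f e ` S e) ` out_arcs G v \<subseteq> sets lborel"
          using similarity_open_image[OF similarity ratio_pos S(1)] out_arcs_arcs by auto
        show "disjoint_family_on (\<lambda>e. f e ` S e) (out_arcs G v)"
          unfolding disjoint_family_on_def
        proof (intro ballI impI)
          fix e e' assume "e \<in> out_arcs G v" "e' \<in> out_arcs G v" "e \<noteq> e'"
          then have "f e ` U (head G e) \<inter> f e' ` U (head G e') = {}"
            by (intro disjoint_U) auto
          then show "f e ` S e \<inter> f e' ` S e' = {}" unfolding S_def by blast
        qed
        show "emeasure lborel (f e ` S e) \<noteq> \<infinity>" if "e \<in> out_arcs G v" for e
          using out_arcs_arcs[OF that] S(2) ratio_pos
          by (intro emeasure_lborel_finite_if_bounded bounded_similarity_image[OF similarity]) (auto intro: less_imp_le)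
      qed (rule finite_out_arcs)
      also have "\<dots> \<le> measure lborel (U v \<inter> ball x (R * d))"
      proof (rule measure_mono_fmeasurable)
        show "(\<Union>e\<in>out_arcs G v. f e ` S e) \<subseteq> U v \<inter> ball x (R * d)"
        proof (rule UN_least)
          fix e assume eo: "e \<in> out_arcs G v"
          then have e: "e \<in> arcs G" by (rule out_arcs_arcs)
          have "f e ` ball (y e) (R * (d / r e)) = ball x (R * d)"
            using ratio_pos[OF e] by (simp add: similarity_image_ball[OF similarity[OF e]] y[OF e])
          moreover have "f e ` U (head G e) \<subseteq> U v" using image_U[OF e] eo by simp
          ultimately show "f e ` S e \<subseteq> U v \<inter> ball x (R * d)" unfolding S_def by blast
        qed
        show "(\<Union>e\<in>out_arcs G v. f e ` S e) \<in> sets lborel"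
          using similarity_open_image[OF similarity ratio_pos S(1)] out_arcs_arcs
          by (auto intro!: borel_open)
        show "U v \<inter> ball x (R * d) \<in> fmeasurable lborel"
          using open_U[OF v] emeasure_bounded_finite[of "U v \<inter> ball x (R * d)"] bounded_U[OF v]
          by (auto simp: fmeasurable_def)
      qed
      finally show ?thesis using c by (simp add: mult_left_mono)
    qed
  qed
  show thesis using c B(1) main by (intro that[of c R]) (auto simp: R_def)
qed

text \<open>The volume factor has served the induction and is now bounded by that of the whole ball,
  which restores the exponent from \<open>t - DIM('a)\<close> to \<open>t\<close>.\<close>

lemma mass_cball_le:
  assumes v: "v \<in> verts G"
  obtains c where "0 < c"
    "\<And>k x d. rmax ^ k \<le> d \<Longrightarrow> d \<le> 1 \<Longrightarrow> mass k v (cball x d) \<le> c * d powr t"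
proof -
  obtain c R where c: "0 < c" "0 < R"
    "\<And>k v x d. v \<in> verts G \<Longrightarrow> rmax ^ k \<le> d \<Longrightarrow> d \<le> 1 / rmin \<Longrightarrow>
      h v * mass k v (cball x d)
        \<le> c * d powr (t - DIM('a)) * measure lborel (U v \<inter> ball x (R * d))"
    using mass_cball_le_volume by metis
  define w where "w = unit_ball_vol (DIM('a)) * R ^ DIM('a)"
  have w: "0 < w" using c(2) by (simp add: w_def unit_ball_vol_pos)
  have "mass k v (cball x d) \<le> c * w / h v * d powr t" if d: "rmax ^ k \<le> d" "d \<le> 1" for k x d
  proof -
    have d0: "0 < d" using d(1) zero_less_power[OF rmax_pos, of k] by linarith
    have "d \<le> 1 / rmin" using d(2) rmin_pos rmin_less_1 d0
      by (simp add: pos_le_divide_eq mult_le_one less_imp_le)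
    then have "h v * mass k v (cball x d)
        \<le> c * d powr (t - DIM('a)) * measure lborel (U v \<inter> ball x (R * d))"
      using c(3)[OF v d(1)] by blast
    also have "\<dots> \<le> c * d powr (t - DIM('a)) * measure lborel (ball x (R * d))"
      using c(1) open_U[OF v]
        emeasure_bounded_finite[of "ball x (R * d)"]
      by (intro mult_left_mono measure_mono_fmeasurable) (auto simp: fmeasurable_def)
    also have "measure lborel (ball x (R * d)) = w * d powr (DIM('a))"
      using c(2) d0 by (simp add: content_ball w_def power_mult_distrib powr_realpow)
    also have "c * d powr (t - DIM('a)) * (w * d powr (DIM('a))) = c * w * d powr t"
      using d0 by (simp add: powr_diff)
    finally show ?thesis using h_pos[OF v] by (simp add: pos_le_divide_eq mult.commute)
  qed
  then show thesis using c(1) w h_pos[OF v] by (intro that[of "c * w / h v"]) auto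
qed

text \<open>The mass distribution principle at a finite level: the level is chosen after the cover,
  fine enough for its smallest radius, while the constant is independent of the level.\<close>

lemma cover_F:
  assumes v: "v \<in> verts G"
  shows "\<exists>c>0. \<forall>(I :: nat set) x \<rho>. finite I \<longrightarrow> (\<forall>i\<in>I. 0 < \<rho> i \<and> \<rho> i \<le> 1) \<longrightarrow>
      F v \<subseteq> (\<Union>i\<in>I. cball (x i) (\<rho> i)) \<longrightarrow> 1 \<le> c * (\<Sum>i\<in>I. \<rho> i powr t)"
proof -
  obtain c where c: "0 < c"
    "\<And>k x d. rmax ^ k \<le> d \<Longrightarrow> d \<le> 1 \<Longrightarrow> mass k v (cball x d) \<le> c * d powr t"
    by (rule mass_cball_le[OF v]) blast
  show ?thesis
  proof (intro exI[of _ c] conjI allI impI c(1))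
    fix I :: "nat set" and x \<rho>
    assume I: "finite I" "\<forall>i\<in>I. 0 < \<rho> i \<and> \<rho> i \<le> 1" "F v \<subseteq> (\<Union>i\<in>I. cball (x i) (\<rho> i))"
    have "0 < Min (insert 1 (\<rho> ` I))" using I(1,2) by simp
    then obtain k where "rmax ^ k \<le> Min (insert 1 (\<rho> ` I))" by (rule ex_rmax_power_le)
    then have k: "rmax ^ k \<le> \<rho> i" if "i \<in> I" for i using that I(1) by simp
    have "1 = mass k v (\<Union>i\<in>I. cball (x i) (\<rho> i))" using mass_eq_1[OF v I(3)] by simp
    also have "\<dots> \<le> (\<Sum>i\<in>I. mass k v (cball (x i) (\<rho> i)))" by (rule mass_UN[OF v I(1)])
    also have "\<dots> \<le> (\<Sum>i\<in>I. c * \<rho> i powr t)"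
      using I(2) by (intro sum_mono c(2) k) auto
    finally show "1 \<le> c * (\<Sum>i\<in>I. \<rho> i powr t)" by (simp add: sum_distrib_left)
  qed
qed

lemma hausdorff_dim_F_ge:
  assumes v: "v \<in> verts G"
  shows "ereal t \<le> hausdorff_dim (F v)"
proof -
  obtain c where c: "0 < c" "\<forall>(I :: nat set) x \<rho>. finite I \<longrightarrow> (\<forall>i\<in>I. 0 < \<rho> i \<and> \<rho> i \<le> 1) \<longrightarrow>
      F v \<subseteq> (\<Union>i\<in>I. cball (x i) (\<rho> i)) \<longrightarrow> 1 \<le> c * (\<Sum>i\<in>I. \<rho> i powr t)"
    using cover_F[OF v] by blast
  show ?thesis by (rule hausdorff_dim_ge[OF compact_F[OF v] c(1) t_nonneg]) (simp add: c(2))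
qed

lemma upper_box_dim_F_ge:
  assumes v: "v \<in> verts G"
  shows "ereal t \<le> upper_box_dim (F v)"
proof -
  obtain c where c: "0 < c" "\<forall>(I :: nat set) x \<rho>. finite I \<longrightarrow> (\<forall>i\<in>I. 0 < \<rho> i \<and> \<rho> i \<le> 1) \<longrightarrow>
      F v \<subseteq> (\<Union>i\<in>I. cball (x i) (\<rho> i)) \<longrightarrow> 1 \<le> c * (\<Sum>i\<in>I. \<rho> i powr t)"
    using cover_F[OF v] by blast
  show ?thesis
  proof (rule upper_box_dim_ge[OF compact_imp_bounded[OF compact_F[OF v]] nonempty_F[OF v] c(1)])
    fix P :: "'a set" and d :: real
    assume P: "finite P" "0 < d" "d \<le> 1" "F v \<subseteq> (\<Union>x\<in>P. cball x d)"
    obtain b where b: "bij_betw b {0..<card P} P" using ex_bij_betw_nat_finite[OF P(1)] by blast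
    have "(\<Union>x\<in>P. cball x d) = (\<Union>i\<in>{0..<card P}. cball (b i) d)"
      by (subst bij_betw_imp_surj_on[OF b, symmetric]) (simp only: image_image)
    then have "1 \<le> c * (\<Sum>i\<in>{0..<card P}. d powr t)"
      using P by (intro c(2)[rule_format]) auto
    then show "1 \<le> c * (real (card P) * d powr t)" by simp
  qed
qed

end

section \<open>Convergence of dimensions\<close>

lemma upper_box_dim_nonneg:
  fixes S :: "'a::euclidean_space set"
  assumes "bounded S" "S \<noteq> {}"
  shows "0 \<le> upper_box_dim S"
proof -
  have "1 \<le> 1 * (real (card P) * d powr 0)"
    if "finite P" "0 < d" "S \<subseteq> (\<Union>x\<in>P. cball x d)" for P and d :: real
  proof -
    have "0 < card P" using that assms(2) by (auto simp: card_gt_0_iff)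
    then show ?thesis using that by simp
  qed
  then have "ereal 0 \<le> upper_box_dim S"
    by (intro upper_box_dim_ge[OF assms, of 1]) auto
  then show ?thesis by (simp add: zero_ereal_def)
qed

text \<open>Reading the ratio off one fixed pair of points turns pointwise convergence of the maps
  into convergence of the ratios.\<close>

lemma similarity_ratio_eq_norm:
  fixes f :: "'a::euclidean_space \<Rightarrow> 'a"
  assumes "similarity \<rho> f" "b \<in> Basis"
  shows "\<rho> = norm (f b - f 0)"
  using assms by (simp add: similarity_def)

text \<open>The only fact to derive is that the ratios are below 1: the contraction bound is tested
  on 0 and a unit vector.\<close>

lemma gdifs_similarity_gdifs:
  fixes f :: "'e \<Rightarrow> 'a::euclidean_space \<Rightarrow> 'a"
  assumes g: "gdifs G C f" and r: "\<And>e. e \<in> arcs G \<Longrightarrow> 0 < r e \<and> similarity (r e) (f e)"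
    and F: "gd_fractal G C f F"
  shows "similarity_gdifs G r C f F"
proof -
  interpret fin_digraph G using g by (simp add: gdifs_def)
  have "r e < 1" if e: "e \<in> arcs G" for e
  proof -
    obtain L where L: "L < 1" "L-lipschitz_on UNIV (f e)"
      using g e by (auto simp: gdifs_def)
    obtain b :: 'a where b: "b \<in> Basis" using nonempty_Basis by blast
    have "r e = dist (f e b) (f e 0)"
      using similarity_ratio_eq_norm[of "r e" "f e" b] r[OF e] b by (simp add: dist_norm)
    also have "\<dots> \<le> L * dist b 0" using L(2) by (rule lipschitz_onD) auto
    finally show ?thesis using b L(1) by simp
  qed
  then show ?thesis
    using g r F by unfold_locales (auto simp: gdifs_def)
qed

lemma gdiosc_osc_gdifs:
  assumes "similarity_gdifs G r C f F" "gdiosc G C f" "supervector G r t h" "0 \<le> t"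
  shows "\<exists>U. osc_gdifs G r C f F U h t"
proof -
  interpret similarity_gdifs G r C f F by (rule assms(1))
  obtain U where U: "\<forall>v\<in>verts G. open (U v) \<and> bounded (U v) \<and> U v \<noteq> {}"
    "\<forall>v\<in>verts G. \<forall>e\<in>out_arcs G v. f e ` U (head G e) \<subseteq> U v"
    "\<forall>e\<in>arcs G. \<forall>e'\<in>arcs G. e \<noteq> e' \<and> tail G e = tail G e' \<longrightarrow>
           f e ` U (head G e) \<inter> f e' ` U (head G e') = {}"
    "\<forall>v\<in>verts G. C v \<subseteq> closure (U v)"
    using assms(2) unfolding gdiosc_def by (elim exE conjE) (rule that)
  have "osc_gdifs G r C f F U h t"
  proof (intro osc_gdifs.intro osc_gdifs_axioms.intro assms(1,3,4))
    show "f e ` U (head G e) \<subseteq> U (tail G e)" if "e \<in> arcs G" for e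
      using U(2) that by auto
    show "f e ` U (head G e) \<inter> f e' ` U (head G e') = {}"
      if "e \<in> arcs G" "e' \<in> arcs G" "e \<noteq> e'" "tail G e = tail G e'" for e e'
      using U(3) that by blast
  qed (simp_all add: U(1,4))
  then show ?thesis by (intro exI[of _ U])
qed

section \<open>Perturbation of the ratios\<close>

text \<open>Positive limit ratios make each power continuous there; at \<open>t = 0\<close> the
  convention \<open>0 powr 0 = 0\<close> would break continuity at ratio 0.\<close>

lemma tendsto_transfer:
  assumes "\<And>e. e \<in> arcs G \<Longrightarrow> (\<lambda>m. rm m e) \<longlonglongrightarrow> r e" "\<And>e. e \<in> arcs G \<Longrightarrow> 0 < r e"
  shows "(\<lambda>m. transfer G (rm m) t h v) \<longlonglongrightarrow> transfer G r t h v"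
  unfolding transfer_def
  by (intro tendsto_sum tendsto_mult tendsto_powr tendsto_const assms)
    (auto simp: out_arcs_def dest: assms(2))

lemma eventually_subvector:
  assumes "finite (verts G)" "\<And>e. e \<in> arcs G \<Longrightarrow> (\<lambda>m. rm m e) \<longlonglongrightarrow> r e"
    "\<And>e. e \<in> arcs G \<Longrightarrow> 0 < r e" "subvector G r t h"
  shows "\<forall>\<^sub>F m in sequentially. subvector G (rm m) t h"
  unfolding subvector_def using assms(4)
  by (intro eventually_ball_finite ballI eventually_conj always_eventually allI assms(1)
      order_tendstoD(2)[OF tendsto_transfer[OF assms(2,3)]])
    (auto simp: subvector_def)

lemma eventually_supervector:
  assumes "finite (verts G)" "\<And>e. e \<in> arcs G \<Longrightarrow> (\<lambda>m. rm m e) \<longlonglongrightarrow> r e"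
    "\<And>e. e \<in> arcs G \<Longrightarrow> 0 < r e" "supervector G r t h"
  shows "\<forall>\<^sub>F m in sequentially. supervector G (rm m) t h"
  unfolding supervector_def using assms(4)
  by (intro eventually_ball_finite ballI eventually_conj always_eventually allI assms(1)
      order_tendstoD(1)[OF tendsto_transfer[OF assms(2,3)]])
    (auto simp: supervector_def)

text \<open>Abstracting over \<open>dim\<close> lets one squeeze serve both dimensions, as well as
  both the given sequence and the constant one.\<close>

lemma dim_tendsto_max:
  fixes dim :: "'a::euclidean_space set \<Rightarrow> ereal"
  assumes upper: "\<And>\<rho> g A t h. similarity_gdifs G \<rho> C g A \<Longrightarrow> subvector G \<rho> t h \<Longrightarrow> 0 \<le> t \<Longrightarrow>
        (\<And>v. v \<in> verts G \<Longrightarrow> dim (C v) < ereal t) \<Longrightarrow> dim (A i) \<le> ereal t"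
    and lower: "\<And>\<rho> g A U h t. osc_gdifs G \<rho> C g A U h t \<Longrightarrow> ereal t \<le> dim (A i)"
    and mono: "\<And>\<rho> g A. similarity_gdifs G \<rho> C g A \<Longrightarrow> dim (C i) \<le> dim (A i)"
    and nonneg: "0 \<le> dim (C i)"
    and eq: "\<And>v. v \<in> verts G \<Longrightarrow> dim (C v) = dim (C i)"
    and gdifs: "\<And>m. gdifs G C (fm m)"
    and rm: "\<And>m e. e \<in> arcs G \<Longrightarrow> similarity (rm m e) (fm m e)"
    and lim: "\<And>e. e \<in> arcs G \<Longrightarrow> (\<lambda>m. rm m e) \<longlonglongrightarrow> r e"
    and pos: "\<And>e. e \<in> arcs G \<Longrightarrow> 0 < r e"
    and osc: "\<And>m. gdiosc G C (fm m)"
    and fractal: "\<And>m. gd_fractal G C (fm m) (Fm m)"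
    and s: "0 \<le> s" "\<And>t. s < t \<Longrightarrow> \<exists>h. subvector G r t h"
      "\<And>t. 0 \<le> t \<Longrightarrow> t < s \<Longrightarrow> \<exists>h. supervector G r t h"
  shows "(\<lambda>m. dim (Fm m i)) \<longlonglongrightarrow> max (ereal s) (dim (C i))"
proof -
  interpret fin_digraph G using gdifs[of 0] by (simp add: gdifs_def)
  have "\<forall>\<^sub>F m in sequentially. \<forall>e\<in>arcs G. 0 < rm m e"
    using order_tendstoD(1)[OF lim pos] by (intro eventually_ball_finite) auto
  \<comment> \<open>Early systems may contain maps of ratio 0, so the bounds are available only from
    some index on.\<close>
  then have sys: "\<forall>\<^sub>F m in sequentially. similarity_gdifs G (rm m) C (fm m) (Fm m)"
    by (rule eventually_mono) (intro gdifs_similarity_gdifs gdifs fractal, simp add: rm)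
  show ?thesis
  proof (rule order_tendstoI)
    fix a assume "a < max (ereal s) (dim (C i))"
    show "\<forall>\<^sub>F m in sequentially. a < dim (Fm m i)"
    proof (cases "a < dim (C i)")
      case True
      show ?thesis using sys by (rule eventually_mono) (use True mono less_le_trans in blast)
    next
      case False
      \<comment> \<open>Nonnegativity of the dimension of \<open>C i\<close> passes to
        \<open>a\<close> and then to \<open>t\<close>, since supervectors are provided for
        nonnegative exponents only.\<close>
      then have "a < ereal s" "0 \<le> a"
        using \<open>a < max (ereal s) (dim (C i))\<close> nonneg by (auto simp: less_max_iff_disj)
      then obtain t where t: "a < ereal t" "ereal t < ereal s"
        using ereal_dense2[of a "ereal s"] by blast
      then have t0: "0 \<le> t" "t < s" using \<open>0 \<le> a\<close> by (auto simp: order_le_less_trans less_imp_le dest: order_le_less_trans)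
      obtain h where h: "supervector G r t h" using s(3)[OF t0] by blast
      have "\<forall>\<^sub>F m in sequentially. supervector G (rm m) t h"
        using eventually_supervector[OF finite_verts lim pos h] .
      with sys show ?thesis
      proof eventually_elim
        case (elim m)
        then obtain U where "osc_gdifs G (rm m) C (fm m) (Fm m) U h t"
          using gdiosc_osc_gdifs[OF _ osc _ t0(1)] by blast
        then have "ereal t \<le> dim (Fm m i)" by (rule lower)
        then show ?case using t(1) by (rule less_le_trans[rotated])
      qed
    qed
  next
    fix a assume "max (ereal s) (dim (C i)) < a"
    then obtain t where t: "max (ereal s) (dim (C i)) < ereal t" "ereal t < a"
      using ereal_dense2 by blast
    then have st: "s < t" "dim (C i) < ereal t" by auto
    obtain h where h: "subvector G r t h" using s(2)[OF st(1)] by blast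
    have "\<forall>\<^sub>F m in sequentially. subvector G (rm m) t h"
      using eventually_subvector[OF finite_verts lim pos h] .
    with sys show "\<forall>\<^sub>F m in sequentially. dim (Fm m i) < a"
    proof eventually_elim
      case (elim m)
      have "dim (Fm m i) \<le> ereal t"
        using upper[OF elim] eq st s(1) by simp
      then show ?case using t(2) by (rule le_less_trans)
    qed
  qed
qed

theorem theorem4p29:
  fixes G :: "('v, 'e) pre_digraph"
    and C :: "'v \<Rightarrow> (real ^ 'n) set"
    and fm :: "nat \<Rightarrow> 'e \<Rightarrow> real ^ 'n \<Rightarrow> real ^ 'n"
    and f :: "'e \<Rightarrow> real ^ 'n \<Rightarrow> real ^ 'n"
    and Fm :: "nat \<Rightarrow> 'v \<Rightarrow> (real ^ 'n) set"
    and F :: "'v \<Rightarrow> (real ^ 'n) set"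
  assumes gdifs_m: "\<And>m. gdifs G C (fm m)"
    and similarity_m: "\<And>m e. e \<in> arcs G \<Longrightarrow> \<exists>\<rho>. similarity \<rho> (fm m e)"
    and converges: "\<And>e x. e \<in> arcs G \<Longrightarrow> (\<lambda>m. fm m e x) \<longlonglongrightarrow> f e x"
    and gdifs_limit: "gdifs G C f"
    and nondegenerate_limit: "\<And>e. e \<in> arcs G \<Longrightarrow> \<exists>\<rho>>0. similarity \<rho> (f e)"
    and gdiosc_m: "\<And>m. gdiosc G C (fm m)"
    and gdiosc_limit: "gdiosc G C f"
    and fractal_m: "\<And>m. gd_fractal G C (fm m) (Fm m)"
    and fractal_limit: "gd_fractal G C f F"
  shows "\<forall>i\<in>verts G.
      ((\<forall>j\<in>verts G. \<forall>k\<in>verts G. upper_box_dim (C j) = upper_box_dim (C k)) \<longrightarrow>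
         (\<lambda>m. upper_box_dim (Fm m i)) \<longlonglongrightarrow> upper_box_dim (F i)) \<and>
      ((\<forall>j\<in>verts G. \<forall>k\<in>verts G. hausdorff_dim (C j) = hausdorff_dim (C k)) \<longrightarrow>
         (\<lambda>m. hausdorff_dim (Fm m i)) \<longlonglongrightarrow> hausdorff_dim (F i))"
proof -
  interpret fin_digraph G using gdifs_limit by (simp add: gdifs_def)
  obtain r where r: "\<And>e. e \<in> arcs G \<Longrightarrow> 0 < r e \<and> similarity (r e) (f e)"
    using nondegenerate_limit by metis
  obtain rm where rm: "\<And>m e. e \<in> arcs G \<Longrightarrow> similarity (rm m e) (fm m e)"
  proof -
    \<comment> \<open>With the membership condition inside the existential, the axiom of choice
      applies to all indices and edges at once.\<close>
    have "\<forall>m e. \<exists>\<rho>. e \<in> arcs G \<longrightarrow> similarity \<rho> (fm m e)" using similarity_m by blast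
    then have "\<exists>rm. \<forall>m e. e \<in> arcs G \<longrightarrow> similarity (rm m e) (fm m e)" by (simp only: choice_iff)
    then show thesis using that by blast
  qed
  have lim: "(\<lambda>m. rm m e) \<longlonglongrightarrow> r e" if e: "e \<in> arcs G" for e
  proof -
    obtain b :: "real ^ 'n" where b: "b \<in> Basis" using nonempty_Basis by blast
    have "(\<lambda>m. norm (fm m e b - fm m e 0)) \<longlonglongrightarrow> norm (f e b - f e 0)"
      by (intro tendsto_intros converges e)
    moreover have "(\<lambda>m. norm (fm m e b - fm m e 0)) = (\<lambda>m. rm m e)"
      using similarity_ratio_eq_norm[OF rm[OF e] b] by auto
    moreover have "norm (f e b - f e 0) = r e"
      using similarity_ratio_eq_norm[OF _ b, of "r e" "f e"] r[OF e] by auto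
    ultimately show ?thesis by simp
  qed
  interpret sys: similarity_gdifs G r C f F
    by (rule gdifs_similarity_gdifs[OF gdifs_limit r fractal_limit])
  obtain s where s: "0 \<le> s" "\<And>t. s < t \<Longrightarrow> \<exists>h. subvector G r t h"
    "\<And>t. 0 \<le> t \<Longrightarrow> t < s \<Longrightarrow> \<exists>h. supervector G r t h"
    using sys.critical_exponent by metis
  have conv: "(\<lambda>m. dim (Fm m i)) \<longlonglongrightarrow> dim (F i)"
    if "\<And>\<rho> g A t h. similarity_gdifs G \<rho> C g A \<Longrightarrow> subvector G \<rho> t h \<Longrightarrow> 0 \<le> t \<Longrightarrow>
        (\<And>v. v \<in> verts G \<Longrightarrow> dim (C v) < ereal t) \<Longrightarrow> dim (A i) \<le> ereal t"
      "\<And>\<rho> g A U h t. osc_gdifs G \<rho> C g A U h t \<Longrightarrow> ereal t \<le> dim (A i)"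
      "\<And>\<rho> g A. similarity_gdifs G \<rho> C g A \<Longrightarrow> dim (C i) \<le> dim (A i)"
      "0 \<le> dim (C i)" "\<And>v. v \<in> verts G \<Longrightarrow> dim (C v) = dim (C i)"
    for dim :: "(real ^ 'n) set \<Rightarrow> ereal" and i
  proof -
    have "(\<lambda>m. dim (Fm m i)) \<longlonglongrightarrow> max (ereal s) (dim (C i))"
      by (rule dim_tendsto_max[where dim = dim and G = G and C = C and fm = fm and rm = rm and r = r])
        (fact that gdifs_m rm lim sys.ratio_pos gdiosc_m fractal_m s)+
    moreover have const: "(\<lambda>m :: nat. r e) \<longlonglongrightarrow> r e" if "e \<in> arcs G" for e by simp
    have "(\<lambda>m :: nat. dim (F i)) \<longlonglongrightarrow> max (ereal s) (dim (C i))"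
      by (rule dim_tendsto_max[where dim = dim and G = G and C = C and fm = "\<lambda>_. f" and rm = "\<lambda>_. r" and r = r])
        (fact that gdifs_limit sys.similarity const sys.ratio_pos gdiosc_limit fractal_limit s)+
    then have "dim (F i) = max (ereal s) (dim (C i))"
      by (simp add: LIMSEQ_const_iff)
    ultimately show ?thesis by simp
  qed
  show ?thesis
  proof (intro ballI conjI impI)
    fix i assume i: "i \<in> verts G"
    assume eq: "\<forall>j\<in>verts G. \<forall>k\<in>verts G. upper_box_dim (C j) = upper_box_dim (C k)"
    show "(\<lambda>m. upper_box_dim (Fm m i)) \<longlonglongrightarrow> upper_box_dim (F i)"
    proof (rule conv)
      show "upper_box_dim (A i) \<le> ereal t"
        if "similarity_gdifs G \<rho> C g A" "subvector G \<rho> t h" "0 \<le> t"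
          "\<And>v. v \<in> verts G \<Longrightarrow> upper_box_dim (C v) < ereal t" for \<rho> g A t h
        using similarity_gdifs.upper_box_dim_F_le[OF that(1-4) i] by blast
      show "ereal t \<le> upper_box_dim (A i)" if "osc_gdifs G \<rho> C g A U h t" for \<rho> g A U h t
        using osc_gdifs.upper_box_dim_F_ge[OF that i] .
      show "upper_box_dim (C i) \<le> upper_box_dim (A i)" if "similarity_gdifs G \<rho> C g A" for \<rho> g A
        using similarity_gdifs.compact_F[OF that i] similarity_gdifs.C_subset_F[OF that i]
        by (intro upper_box_dim_mono compact_imp_bounded)
      show "0 \<le> upper_box_dim (C i)"
        using sys.compact_C[OF i] sys.nonempty_C[OF i] by (intro upper_box_dim_nonneg compact_imp_bounded)
      show "upper_box_dim (C v) = upper_box_dim (C i)" if "v \<in> verts G" for v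
        using eq i that by blast
    qed
  next
    fix i assume i: "i \<in> verts G"
    assume eq: "\<forall>j\<in>verts G. \<forall>k\<in>verts G. hausdorff_dim (C j) = hausdorff_dim (C k)"
    show "(\<lambda>m. hausdorff_dim (Fm m i)) \<longlonglongrightarrow> hausdorff_dim (F i)"
    proof (rule conv)
      show "hausdorff_dim (A i) \<le> ereal t"
        if "similarity_gdifs G \<rho> C g A" "subvector G \<rho> t h" "0 \<le> t"
          "\<And>v. v \<in> verts G \<Longrightarrow> hausdorff_dim (C v) < ereal t" for \<rho> g A t h
        using similarity_gdifs.hausdorff_dim_F_le[OF that(1-4) i] by blast
      show "ereal t \<le> hausdorff_dim (A i)" if "osc_gdifs G \<rho> C g A U h t" for \<rho> g A U h t
        using osc_gdifs.hausdorff_dim_F_ge[OF that i] .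
      show "hausdorff_dim (C i) \<le> hausdorff_dim (A i)" if "similarity_gdifs G \<rho> C g A" for \<rho> g A
        using similarity_gdifs.C_subset_F[OF that i] by (rule hausdorff_dim_mono)
      show "hausdorff_dim (C v) = hausdorff_dim (C i)" if "v \<in> verts G" for v
        using eq i that by blast
    qed (rule hausdorff_dim_nonneg)
  qed
qed

end
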